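(* There exist absolute constants $C>0$ and $\alpha\ge 0$ (independent of $p$ and $A$) such that the following holds. Let $p$ be a prime, let $\mathbb{F}_p$ be the field with $p$ elements, and let $A\subset \mathbb{F}_p$ satisfy $2\le |A| < p^{1/2}$. Then $$|A|^{14/13} \le C(\log |A|)^{\alpha}\,\max\big(|AA|,\,|A+A|\big),$$ where $A+A=\{a+b: a,b\in A\}$ and $AA=\{ab: a,b\in A\}$. In the paper's notation: $\max(|AA|,|A+A|)\gtrapprox |A|^{14/13}$.
   Context: For a finite set $B$, $|B|$ denotes its cardinality. The paper writes $X\lessapprox Y$ to mean $X\le C(\log|A|)^{\alpha}Y$ for absolute constants $C,\alpha$, and $X\gtrapprox Y$ for $Y\lessapprox X$. *)

theory Defs
  imports Complex_Main "HOL-Number_Theory.Residues"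
begin

end

(*
Write n = |A| and M = max (|AA|, |A+A|). By Cauchy-Schwarz some b in A satisfies
sum_{a in A} |aA cap bA| >= n^3 / M, and a harmonic pigeonhole gives a threshold N and a set
A1 = {a in A : |aA cap bA| >= N} with N |A1| (1 + ln n) >= n^3 / M. For such a, most of a A1 is covered
by 8 M / N translates of -bA; hence for x, y, u, v in A1 there is B <= A1 with |B| >= |A1| / 2 and
|(x-y)B + (u-v)B| <= (8 M / N)^4 |2A - 2A| <= 2^16 M^8 / (N^4 n^3), using Pluennecke and Ruzsa.

From below, let Q be the set of quotients of differences of A1. If q lies in Q and q + 1 does not,
then for q = (u-v)/(x-y) all sums (x-y)s + (x-y+u-v)r with s, r in A1 are distinct, and Pluennecke
gives |B|^3 <= 4 |A+A| |(x-y)B + (u-v)B|. Otherwise Q is the whole field, and since |A1|^2 < p some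
quotient in Q has few additive collisions. Both cases give |A1|^3 <= 32 M |(x-y)B + (u-v)B|, and
combining the bounds yields n^14 <= 2^21 M^13 (1 + ln n)^4.
*)
theory Submission
  imports Defs "HOL-Analysis.Convex"
begin

no_notation Sum_Type.Plus (infixr "<+>" 65)

section \<open>Sumsets in abelian groups\<close>

context abelian_group
begin

section \<open>Elementary calculus of sumsets\<close>

lemma set_add_iff: "x \<in> A <+> B \<longleftrightarrow> (\<exists>a\<in>A. \<exists>b\<in>B. x = a \<oplus> b)"
  by (auto simp: set_add_def')

lemma set_addI: "a \<in> A \<Longrightarrow> b \<in> B \<Longrightarrow> a \<oplus> b \<in> A <+> B"
  by (auto simp: set_add_iff)

lemma set_add_mono: "A \<subseteq> A' \<Longrightarrow> B \<subseteq> B' \<Longrightarrow> A <+> B \<subseteq> A' <+> B'"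
  unfolding set_add_def' by (intro UN_mono) auto

lemma set_add_eq_image: "A <+> B = (\<lambda>(a, b). a \<oplus> b) ` (A \<times> B)"
  by (auto simp: set_add_def' intro!: rev_image_eqI)

lemma finite_set_add [simp, intro]: "finite A \<Longrightarrow> finite B \<Longrightarrow> finite (A <+> B)"
  by (simp add: set_add_eq_image)

lemma set_add_subset [simp, intro]:
  "A \<subseteq> carrier G \<Longrightarrow> B \<subseteq> carrier G \<Longrightarrow> A <+> B \<subseteq> carrier G"
  by (rule set_add_closed)

lemma set_add_commute:
  assumes "A \<subseteq> carrier G" "B \<subseteq> carrier G"
  shows "A <+> B = B <+> A"
proof -
  have "A <+> B = (\<Union>a\<in>A. \<Union>b\<in>B. {b \<oplus> a})"
    unfolding set_add_def' using assms by (intro SUP_cong refl) (simp add: a_comm subset_iff)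
  also have "\<dots> = B <+> A"
    unfolding set_add_def' by auto
  finally show ?thesis .
qed

lemma set_add_assoc:
  assumes "A \<subseteq> carrier G" "B \<subseteq> carrier G" "C \<subseteq> carrier G"
  shows "A <+> B <+> C = A <+> (B <+> C)"
  using add.set_mult_assoc[OF assms] by (simp add: set_add_def)

lemma set_add_empty [simp]: "A <+> {} = {}" "{} <+> A = {}"
  by (auto simp: set_add_iff)

lemma set_add_Un_left: "(A \<union> B) <+> C = (A <+> C) \<union> (B <+> C)"
  and set_add_Un_right: "A <+> (B \<union> C) = (A <+> B) \<union> (A <+> C)"
  by (simp_all add: set_add_def' UN_Un UN_Un_distrib)

lemma card_set_add_le: "finite A \<Longrightarrow> finite B \<Longrightarrow> card (A <+> B) \<le> card A * card B"
  using card_image_le[of "A \<times> B" "\<lambda>(a, b). a \<oplus> b"]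
  by (simp add: set_add_eq_image card_cartesian_product)

lemma card_set_add_singleton:
  assumes "A \<subseteq> carrier G" "c \<in> carrier G"
  shows "card (A <+> {c}) = card A"
proof -
  have "A <+> {c} = (\<lambda>a. a \<oplus> c) ` A"
    by (auto simp: set_add_iff)
  moreover have "inj_on (\<lambda>a. a \<oplus> c) A"
    using assms by (intro inj_onI) (meson add.right_cancel subsetD)
  ultimately show ?thesis
    by (simp add: card_image)
qed

lemma card_le_card_set_add:
  assumes "A \<subseteq> carrier G" "B \<subseteq> carrier G" "finite A" "finite B" "B \<noteq> {}"
  shows "card A \<le> card (A <+> B)"
proof -
  obtain b where "b \<in> B"
    using assms by auto
  then have "card (A <+> {b}) \<le> card (A <+> B)"
    using assms by (intro card_mono set_add_mono) auto
  then show ?thesis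
    using \<open>b \<in> B\<close> assms card_set_add_singleton[of A b] by auto
qed

section \<open>The inequalities of Ruzsa and Pluennecke\<close>

text \<open>Fix one representation \<open>y - z\<close> of each difference \<open>d\<close>. The
  pair \<open>(x + y, x + z)\<close> then determines \<open>d\<close> as the difference of its
  coordinates, hence \<open>y\<close>, and finally \<open>x\<close> by cancellation.\<close>

lemma ruzsa_triangle:
  assumes X: "X \<subseteq> carrier G" "finite X" and Y: "Y \<subseteq> carrier G" "finite Y"
    and Z: "Z \<subseteq> carrier G" "finite Z"
  shows "card (Y <+> a_inv G ` Z) * card X \<le> card (X <+> Y) * card (X <+> Z)"
proof -
  define D where "D = Y <+> a_inv G ` Z"
  have "\<forall>d\<in>D. \<exists>q\<in>Y \<times> Z. d = fst q \<ominus> snd q"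
    by (auto simp: D_def set_add_iff a_minus_def)
  then obtain q where q: "\<And>d. d \<in> D \<Longrightarrow> q d \<in> Y \<times> Z \<and> d = fst (q d) \<ominus> snd (q d)"
    by metis
  define h where "h = (\<lambda>(d, x). (x \<oplus> fst (q d), x \<oplus> snd (q d)))"
  have "inj_on h (D \<times> X)"
  proof (rule inj_onI, clarify)
    fix d x d' x'
    assume a: "d \<in> D" "x \<in> X" "d' \<in> D" "x' \<in> X" "h (d, x) = h (d', x')"
    have c: "x \<in> carrier G" "x' \<in> carrier G" "fst (q d) \<in> carrier G" "snd (q d) \<in> carrier G"
      "fst (q d') \<in> carrier G" "snd (q d') \<in> carrier G"
      using a(1-4) q X Y Z by (auto simp: mem_Times_iff)
    have e: "(x \<oplus> y) \<ominus> (x \<oplus> z) = y \<ominus> z"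
      if "x \<in> carrier G" "y \<in> carrier G" "z \<in> carrier G" for x y z
    proof -
      have "(x \<oplus> y) \<ominus> (x \<oplus> z) = (y \<oplus> x) \<oplus> (\<ominus> x \<oplus> \<ominus> z)"
        using that by (simp add: a_minus_def minus_add a_comm)
      also have "\<dots> = y \<oplus> (x \<oplus> (\<ominus> x \<oplus> \<ominus> z))"
        using that by (simp add: a_assoc)
      also have "x \<oplus> (\<ominus> x \<oplus> \<ominus> z) = \<ominus> z"
        using that by (simp add: r_neg2)
      finally show ?thesis by (simp add: a_minus_def)
    qed
    have "d = (x \<oplus> fst (q d)) \<ominus> (x \<oplus> snd (q d))"
      using e[of x "fst (q d)" "snd (q d)"] c q[OF a(1)] by simp
    also have "\<dots> = (x' \<oplus> fst (q d')) \<ominus> (x' \<oplus> snd (q d'))"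
      using a(5) by (simp add: h_def)
    also have "\<dots> = d'"
      using e[of x' "fst (q d')" "snd (q d')"] c q[OF a(3)] by simp
    finally have "d = d'" .
    moreover from this have "x = x'"
      using a(5) c by (simp add: h_def)
    ultimately show "d = d' \<and> x = x'" by simp
  qed
  moreover have "h ` (D \<times> X) \<subseteq> (X <+> Y) \<times> (X <+> Z)"
    using q by (fastforce simp: h_def mem_Times_iff intro!: set_addI)
  ultimately have "card (D \<times> X) \<le> card ((X <+> Y) \<times> (X <+> Z))"
    using X Y Z by (intro card_inj_on_le[of h]) auto
  then show ?thesis
    by (simp add: D_def card_cartesian_product)
qed

text \<open>Petridis's induction, run for a weighted sum of two growths. Adjoining \<open>c\<close>
  to \<open>C\<close> enlarges \<open>X <+> C\<close> by exactly the translates of the points of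
  \<open>X - Z\<close>, and enlarges each \<open>X <+> C <+> B\<close> by at most
  \<open>card (X <+> B) - card (Z <+> B)\<close>. The minimality hypothesis, applied to
  \<open>Z\<close>, balances the two gains.\<close>

lemma petridis_weighted:
  fixes w1 w2 k :: real
  assumes X: "X \<subseteq> carrier G" "finite X"
    and B1: "B1 \<subseteq> carrier G" "finite B1" and B2: "B2 \<subseteq> carrier G" "finite B2"
    and w: "w1 \<ge> 0" "w2 \<ge> 0"
    and eq: "w1 * card (X <+> B1) + w2 * card (X <+> B2) = k * card X"
    and min: "\<And>Z. Z \<subseteq> X \<Longrightarrow> k * card Z \<le> w1 * card (Z <+> B1) + w2 * card (Z <+> B2)"
    and C: "finite C" "C \<subseteq> carrier G"
  shows "w1 * card (X <+> C <+> B1) + w2 * card (X <+> C <+> B2) \<le> k * card (X <+> C)"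
  using C
proof (induction C rule: finite_induct)
  case empty
  then show ?case by simp
next
  case (insert c C)
  define Z where "Z = {x \<in> X. x \<oplus> c \<in> X <+> C}"
  have c: "c \<in> carrier G" "C \<subseteq> carrier G" and Z: "Z \<subseteq> X" "Z \<subseteq> carrier G" "finite Z"
    using insert.prems X by (auto simp: Z_def)
  have XC: "X <+> insert c C = (X <+> C) \<union> ((X - Z) <+> {c})"
    unfolding set_add_def' Z_def by blast
  have "(X <+> C) \<inter> ((X - Z) <+> {c}) = {}"
    by (auto simp: Z_def set_add_iff[of _ _ "{c}"])
  then have "card (X <+> insert c C) = card (X <+> C) + card ((X - Z) <+> {c})"
    unfolding XC using X insert.hyps by (intro card_Un_disjoint) auto
  also have "card ((X - Z) <+> {c}) = card (X - Z)"
    using X c by (intro card_set_add_singleton) auto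
  also have "card (X - Z) = card X - card Z"
    using Z by (intro card_Diff_subset) auto
  finally have card1: "real (card (X <+> insert c C)) = card (X <+> C) + (real (card X) - card Z)"
    using card_mono[OF X(2) Z(1)] by simp
  have card2: "real (card (X <+> insert c C <+> B)) \<le>
      card (X <+> C <+> B) + (real (card (X <+> B)) - card (Z <+> B))"
    if B: "B \<subseteq> carrier G" "finite B" for B
  proof -
    have swap: "S <+> {c} <+> B = S <+> B <+> {c}" if "S \<subseteq> carrier G" for S
      using that B c by (metis empty_subsetI insert_subset set_add_assoc set_add_commute)
    \<comment> \<open>This part of \<open>X <+> B <+> {c}\<close> is already present, so it may be
      discarded when new elements are counted.\<close>
    have ZC: "Z <+> B <+> {c} \<subseteq> X <+> C <+> B"
    proof -
      have "Z <+> {c} \<subseteq> X <+> C"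
        by (auto simp: Z_def set_add_iff)
      then show ?thesis
        using swap[OF Z(2)] set_add_mono[of "Z <+> {c}" "X <+> C" B B] by simp
    qed
    have "X <+> insert c C <+> B = (X <+> C <+> B) \<union> (X <+> {c} <+> B)"
      using set_add_Un_right[of X C "{c}"] by (simp add: set_add_Un_left)
    also have "\<dots> = (X <+> C <+> B) \<union> ((X <+> B <+> {c}) - (Z <+> B <+> {c}))"
      using ZC swap[OF X(1)] by auto
    finally have "card (X <+> insert c C <+> B) =
        card ((X <+> C <+> B) \<union> ((X <+> B <+> {c}) - (Z <+> B <+> {c})))"
      by simp
    also have "\<dots> \<le> card (X <+> C <+> B) + card ((X <+> B <+> {c}) - (Z <+> B <+> {c}))"
      by (rule card_Un_le)
    also have "card ((X <+> B <+> {c}) - (Z <+> B <+> {c})) = 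
        card (X <+> B <+> {c}) - card (Z <+> B <+> {c})"
      using Z B by (intro card_Diff_subset set_add_mono) auto
    also have "\<dots> = card (X <+> B) - card (Z <+> B)"
      using X Z B c by (subst (1 2) card_set_add_singleton) auto
    finally have *: "card (X <+> insert c C <+> B)
      \<le> card (X <+> C <+> B) + (card (X <+> B) - card (Z <+> B))" .
    have "card (Z <+> B) \<le> card (X <+> B)"
      using X B Z by (intro card_mono set_add_mono) auto
    with * show ?thesis by linarith
  qed
  have "w1 * card (X <+> insert c C <+> B1) + w2 * card (X <+> insert c C <+> B2)
      \<le> w1 * (card (X <+> C <+> B1) + (real (card (X <+> B1)) - card (Z <+> B1)))
        + w2 * (card (X <+> C <+> B2) + (real (card (X <+> B2)) - card (Z <+> B2)))"
    by (intro add_mono mult_left_mono card2 w B1 B2)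
  also have "\<dots> = (w1 * card (X <+> C <+> B1) + w2 * card (X <+> C <+> B2))
      + (w1 * card (X <+> B1) + w2 * card (X <+> B2))
      - (w1 * card (Z <+> B1) + w2 * card (Z <+> B2))"
    by (simp add: algebra_simps)
  also have "\<dots> \<le> k * card (X <+> C) + k * card X - k * card Z"
    using insert.IH[OF c(2)] eq min[OF Z(1)] by linarith
  also have "\<dots> = k * card (X <+> insert c C)"
    by (simp add: card1 algebra_simps)
  finally show ?case .
qed

text \<open>Minimising the sum of the two growth ratios, each normalised by its bound, yields one \<open>X\<close>
  that serves \<open>B1\<close> and \<open>B2\<close> at once; minimising for a single summand would lose a factor
  \<open>card Y / card X\<close>.\<close>

lemma pluennecke_two_summands:
  fixes a1 a2 :: real
  assumes Y: "Y \<subseteq> carrier G" "finite Y" "Y \<noteq> {}"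
    and B1: "B1 \<subseteq> carrier G" "finite B1" "B1 \<noteq> {}"
    and B2: "B2 \<subseteq> carrier G" "finite B2" "B2 \<noteq> {}"
    and a1: "card (Y <+> B1) \<le> a1 * card Y" and a2: "card (Y <+> B2) \<le> a2 * card Y"
  obtains X where "X \<subseteq> Y" "X \<noteq> {}" "card (X <+> B1 <+> B2) \<le> 4 * a1 * a2 * card X"
proof -
  have posY: "card Y > 0"
    using Y by (simp add: card_gt_0_iff)
  have pos: "a > 0" if "B \<subseteq> carrier G" "finite B" "B \<noteq> {}" "card (Y <+> B) \<le> a * card Y" for a :: real and B
  proof -
    have "0 < real (card (Y <+> B))"
      using card_le_card_set_add[OF Y(1) that(1) Y(2) that(2,3)] posY by linarith
    then have "0 < a * card Y"
      using that(4) by linarith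
    then show ?thesis
      using posY zero_less_mult_pos2 of_nat_0_less_iff by blast
  qed
  have p: "a1 > 0" "a2 > 0"
    using pos[OF B1 a1] pos[OF B2 a2] .
  define W where "W X = 1 / a1 * card (X <+> B1) + 1 / a2 * card (X <+> B2)" for X
  define S where "S = Pow Y - {{}}"
  have "finite S" "S \<noteq> {}"
    using Y by (auto simp: S_def)
  then obtain X where X: "X \<in> S" and Xmin: "\<And>Z. Z \<in> S \<Longrightarrow> W X / card X \<le> W Z / card Z"
    using arg_min_if_finite[of S "\<lambda>Z. W Z / card Z"] by (meson not_le)
  define k where "k = W X / card X"
  have Xc: "X \<subseteq> carrier G" "finite X" "X \<noteq> {}" and posX: "card X > 0"
    using X Y by (auto simp: S_def card_gt_0_iff dest: finite_subset)
  \<comment> \<open>\<open>Y\<close> itself competes for the minimum, and each of the two normalised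
    terms of \<open>W Y\<close> is at most \<open>card Y\<close>.\<close>
  have k2: "k \<le> 2"
  proof -
    have "k \<le> W Y / card Y"
      unfolding k_def using Xmin[of Y] Y by (simp add: S_def)
    moreover have "W Y \<le> real (card Y) + real (card Y)"
      unfolding W_def using a1 a2 p by (intro add_mono) (auto simp: field_simps)
    then have "W Y / card Y \<le> 2"
      using posY by (simp add: field_simps)
    ultimately show ?thesis by linarith
  qed
  have eq: "1 / a1 * card (X <+> B1) + 1 / a2 * card (X <+> B2) = k * card X"
    using posX by (simp add: k_def W_def)
  have min: "k * card Z \<le> 1 / a1 * card (Z <+> B1) + 1 / a2 * card (Z <+> B2)" if "Z \<subseteq> X" for Z
  proof (cases "Z = {}")
    case False
    then have "Z \<in> S" "card Z > 0"
      using that X Xc by (auto simp: S_def card_gt_0_iff dest: finite_subset)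
    then show ?thesis
      using Xmin[of Z] by (simp add: k_def[symmetric] pos_le_divide_eq) (simp add: W_def)
  qed simp
  have k0: "k \<ge> 0"
    using p by (simp add: k_def W_def)
  \<comment> \<open>Here \<open>B2\<close> plays two roles: it is the set \<open>C\<close> of the
    induction as well as the second summand. Dropping the second term leaves only the triple sumset
    that is wanted.\<close>
  have "1 / a1 * card (X <+> B2 <+> B1) + 1 / a2 * card (X <+> B2 <+> B2) \<le> k * card (X <+> B2)"
    using petridis_weighted[OF Xc(1,2) B1(1,2) B2(1,2) _ _ eq min B2(2,1)] p by simp
  moreover have "0 \<le> 1 / a2 * card (X <+> B2 <+> B2)"
    using p by simp
  ultimately have "1 / a1 * card (X <+> B2 <+> B1) \<le> k * card (X <+> B2)"
    by linarith
  then have 1: "card (X <+> B2 <+> B1) \<le> a1 * (k * card (X <+> B2))"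
    using p by (simp add: field_simps)
  \<comment> \<open>Dropping the first term of \<open>eq\<close> instead bounds
    \<open>X <+> B2\<close>. The two bounds together cost \<open>k * k\<close>, which is where the
    factor 4 comes from.\<close>
  have "0 \<le> 1 / a1 * card (X <+> B1)"
    using p by simp
  then have "1 / a2 * card (X <+> B2) \<le> k * card X"
    using eq by linarith
  then have "card (X <+> B2) \<le> a2 * (k * card X)"
    using p by (simp add: field_simps)
  then have "a1 * (k * card (X <+> B2)) \<le> a1 * (k * (a2 * (k * card X)))"
    using p k0 by (intro mult_left_mono) auto
  also have "\<dots> = k * k * (a1 * a2 * card X)"
    by simp
  also have "\<dots> \<le> 2 * 2 * (a1 * a2 * card X)"
    using p k0 k2 by (intro mult_right_mono mult_mono) auto
  finally have "card (X <+> B2 <+> B1) \<le> 4 * a1 * a2 * card X"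
    using 1 by simp
  moreover have "X <+> B2 <+> B1 = X <+> B1 <+> B2"
    using Xc B1 B2 by (metis set_add_assoc set_add_commute)
  ultimately show ?thesis
    using that[of X] X by (simp add: S_def)
qed

text \<open>Pluennecke gives \<open>X\<close> inside \<open>A\<close> with
  \<open>X <+> A <+> A\<close> at most \<open>4 * (M / n)^2\<close> times as large as
  \<open>X\<close>. The Ruzsa triangle inequality with pivot \<open>X\<close> squares this ratio,
  and the remaining factor \<open>card X\<close> is at most \<open>n\<close>.\<close>

lemma card_double_difference_le:
  fixes M :: real
  assumes A: "A \<subseteq> carrier G" "finite A" "A \<noteq> {}" and M: "card (A <+> A) \<le> M"
  shows "card (A <+> A <+> a_inv G ` (A <+> A)) * real (card A) ^ 3 \<le> 16 * M ^ 4"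
proof -
  define n where "n = real (card A)"
  have n: "n > 0"
    using A by (simp add: n_def card_gt_0_iff)
  have le: "card (A <+> A) \<le> M / n * card A"
    using M n by (simp add: n_def)
  obtain X where X: "X \<subseteq> A" "X \<noteq> {}" "card (X <+> A <+> A) \<le> 4 * (M / n) * (M / n) * card X"
    by (rule pluennecke_two_summands[OF A A A le le])
  have Xc: "X \<subseteq> carrier G" "finite X"
    using X(1) A(1) finite_subset[OF X(1) A(2)] by auto
  define x where "x = real (card X)"
  have x: "x > 0" "x \<le> n"
    using Xc X A(2) by (auto simp: x_def n_def card_gt_0_iff card_mono)
  have "real (card (A <+> A <+> a_inv G ` (A <+> A))) * x
      \<le> real (card (X <+> (A <+> A))) * card (X <+> (A <+> A))"
    using ruzsa_triangle[OF Xc, of "A <+> A" "A <+> A"] A(1,2)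
    unfolding x_def of_nat_mult[symmetric] of_nat_le_iff by simp
  also have "X <+> (A <+> A) = X <+> A <+> A"
    using Xc A by (simp add: set_add_assoc)
  also have "real (card (X <+> A <+> A)) * card (X <+> A <+> A)
      \<le> (4 * (M / n) * (M / n) * x) * (4 * (M / n) * (M / n) * x)"
    using X(3) by (intro mult_mono) (auto simp: x_def)
  also have "\<dots> = (16 * M ^ 4 / n ^ 4 * x) * x"
    by (simp add: field_simps power4_eq_xxxx)
  finally have "real (card (A <+> A <+> a_inv G ` (A <+> A))) \<le> 16 * M ^ 4 / n ^ 4 * x"
    using x(1) by (rule mult_right_le_imp_le)
  also have "\<dots> \<le> 16 * M ^ 4 / n ^ 4 * n"
    using x by (intro mult_left_mono) auto
  finally show ?thesis
    using n by (simp add: n_def[symmetric] field_simps power4_eq_xxxx power3_eq_cube)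
qed

section \<open>Covering by few translates\<close>

text \<open>Choosing \<open>T\<close> to maximise the number of covered points minus a fixed cost for each
  translate makes both the uncovered part and \<open>T\<close> small at the same time.\<close>

lemma covering_by_translates:
  fixes \<epsilon> :: real
  assumes C: "C \<subseteq> carrier G" "finite C" "C \<noteq> {}" and D: "D \<subseteq> carrier G" "finite D" "D \<noteq> {}"
    and \<epsilon>: "\<epsilon> > 0"
  obtains T where "T \<subseteq> carrier G" "finite T" "card T \<le> card (C <+> D) / (\<epsilon> * card D)"
    "card (C - (T <+> a_inv G ` D)) \<le> \<epsilon> * card C"
proof -
  define cov where "cov T = C \<inter> (T <+> a_inv G ` D)" for T
  have pos: "card C > 0" "card D > 0"
    using C(2,3) D(2,3) by (simp_all add: card_gt_0_iff)
  have posS: "card (C <+> D) > 0"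
    using pos card_le_card_set_add[OF C(1) D(1) C(2) D(2,3)] by linarith
  \<comment> \<open>This cost is the critical multiplicity: if more than
    \<open>\<epsilon> * card C\<close> points stay uncovered, then on average over
    \<open>C <+> D\<close> a sum has more than \<open>l\<close> representations by an uncovered
    point and an element of \<open>D\<close>.\<close>
  define l where "l = \<epsilon> * card C * card D / card (C <+> D)"
  have l: "l > 0"
    using pos posS \<epsilon> by (simp add: l_def)
  define val where "val T = card (cov T) - l * card T" for T
  have "finite (Pow (C <+> D))" "Pow (C <+> D) \<noteq> {}"
    using C D by auto
  then obtain T where T: "T \<subseteq> C <+> D" and Tmax: "\<And>T'. T' \<subseteq> C <+> D \<Longrightarrow> val T' \<le> val T"
    using arg_min_if_finite[of "Pow (C <+> D)" "\<lambda>T. - val T"]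
    by (metis Pow_iff neg_less_iff_less not_le)
  have Tc: "T \<subseteq> carrier G" "finite T"
    using subset_trans[OF T set_add_subset] finite_subset[OF T] C D by auto
  have cardT: "card T \<le> card (C <+> D) / (\<epsilon> * card D)"
  proof -
    \<comment> \<open>The empty set competes with value 0, so the total cost of \<open>T\<close>
      cannot exceed the number of points it covers.\<close>
    have "0 \<le> val T"
      using Tmax[of "{}"] by (simp add: val_def cov_def)
    then have "l * card T \<le> card (cov T)"
      by (simp add: val_def)
    also have "\<dots> \<le> card C"
      using C by (simp add: cov_def card_mono)
    finally show ?thesis
      using pos posS \<epsilon> by (simp add: l_def field_simps)
  qed
  define R where "R = C - (T <+> a_inv G ` D)"
  have R: "finite R" "R \<subseteq> C"
    using C by (auto simp: R_def)
  have "card R \<le> \<epsilon> * card C"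
  proof (rule ccontr)
    assume "\<not> card R \<le> \<epsilon> * card C"
    then have big: "card R * real (card D) > \<epsilon> * card C * card D"
      using pos by simp
    \<comment> \<open>Adjoining \<open>t\<close> to \<open>T\<close> would cover every uncovered
      \<open>c\<close> with \<open>t - c\<close> in \<open>D\<close>, at an extra cost of at most
      \<open>l\<close>. By the maximality of \<open>val T\<close> there are at most \<open>l\<close>
      such points.\<close>
    have le: "card {(c, d) \<in> R \<times> D. c \<oplus> d = t} \<le> l" if t: "t \<in> C <+> D" for t
    proof -
      define U where "U = {(c, d) \<in> R \<times> D. c \<oplus> d = t}"
      have tc: "t \<in> carrier G"
        using t set_add_subset[OF C(1) D(1)] by auto
      have "inj_on fst U"
        using C D R by (auto simp: U_def inj_on_def subset_iff)
      then have "card U = card (fst ` U)"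
        by (simp add: card_image)
      also have "card (fst ` U) + card (cov T) \<le> card (cov (insert t T))"
      proof -
        have "fst ` U \<inter> cov T = {}" and sub: "fst ` U \<subseteq> C"
          using R by (auto simp: U_def cov_def R_def)
        moreover have "fst ` U \<subseteq> cov (insert t T)"
        proof
          fix c assume "c \<in> fst ` U"
          then obtain d where cd: "c \<in> R" "d \<in> D" "c \<oplus> d = t"
            by (auto simp: U_def)
          then have cd': "c \<in> carrier G" "d \<in> carrier G" "c \<in> C"
            using R C D by auto
          have "t \<oplus> \<ominus> d = c"
            using cd cd' by (simp add: a_assoc r_neg flip: cd(3))
          then show "c \<in> cov (insert t T)"
            using cd cd' by (auto simp: cov_def set_add_iff)
        qed
        moreover have "cov T \<subseteq> cov (insert t T)"
          by (auto simp: cov_def set_add_iff)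
        ultimately show ?thesis
          using C card_Un_disjoint[of "fst ` U" "cov T"] 
            card_mono[of "cov (insert t T)" "fst ` U \<union> cov T"] finite_subset[OF sub]
          by (auto simp: cov_def)
      qed
      finally have "real (card U) \<le> card (cov (insert t T)) - real (card (cov T))"
        by linarith
      also have "\<dots> = val (insert t T) - val T + l * (real (card (insert t T)) - card T)"
        by (simp add: val_def algebra_simps)
      also have "\<dots> \<le> l * (real (card (insert t T)) - card T)"
        using Tmax[of "insert t T"] t T by simp
      also have "\<dots> \<le> l * 1"
        using l Tc card_insert_if[of T t] by (intro mult_left_mono) auto
      finally show ?thesis
        by (simp add: U_def)
    qed
    have "card R * real (card D) = card (R \<times> D)"
      by (simp add: card_cartesian_product)
    also have "R \<times> D = (\<Union>t\<in>C <+> D. {(c, d) \<in> R \<times> D. c \<oplus> d = t})"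
      using R by (auto intro!: set_addI)
    also have "real (card \<dots>) \<le> (\<Sum>t\<in>C <+> D. card {(c, d) \<in> R \<times> D. c \<oplus> d = t})"
      unfolding of_nat_le_iff using C D by (intro card_UN_le) auto
    also have "\<dots> = (\<Sum>t\<in>C <+> D. real (card {(c, d) \<in> R \<times> D. c \<oplus> d = t}))"
      by simp
    also have "\<dots> \<le> card (C <+> D) * l"
      using le by (intro sum_bounded_above) auto
    also have "\<dots> = \<epsilon> * card C * card D"
      using posS by (simp add: l_def)
    finally show False
      using big by simp
  qed
  with Tc cardT show ?thesis
    using that[of T] by (simp add: R_def)
qed

end

section \<open>Sums of dilates in fields\<close>

text \<open>Cauchy-Schwarz over the fibres of \<open>g\<close>: their sizes add up to
  \<open>card S\<close>, and the squares of their sizes add up to the number of collisions.\<close>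

lemma card_squared_le_collisions:
  assumes "finite S"
  shows "(card S)\<^sup>2 \<le> card (g ` S) * card {(s, t) \<in> S \<times> S. g s = g t}"
proof -
  define F where "F v = {s \<in> S. g s = v}" for v
  have fin: "finite (F v)" for v
    using assms by (simp add: F_def)
  have "card S = card (\<Union>v\<in>g ` S. F v)"
    by (rule arg_cong[where f = card]) (auto simp: F_def)
  also have "\<dots> = (\<Sum>v\<in>g ` S. card (F v))"
    using assms fin by (intro card_UN_disjoint) (auto simp: F_def)
  finally have 1: "card S = (\<Sum>v\<in>g ` S. card (F v))" .
  have "{(s, t) \<in> S \<times> S. g s = g t} = (\<Union>v\<in>g ` S. F v \<times> F v)"
    by (auto simp: F_def)
  also have "card \<dots> = (\<Sum>v\<in>g ` S. card (F v \<times> F v))"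
    using assms fin by (intro card_UN_disjoint) (auto simp: F_def)
  also have "\<dots> = (\<Sum>v\<in>g ` S. (card (F v))\<^sup>2)"
    by (simp add: card_cartesian_product power2_eq_square)
  finally have 2: "card {(s, t) \<in> S \<times> S. g s = g t} = (\<Sum>v\<in>g ` S. (card (F v))\<^sup>2)" .
  have "(\<Sum>v\<in>g ` S. real (card (F v)))\<^sup>2 \<le> (\<Sum>v\<in>g ` S. (real (card (F v)))\<^sup>2) * card (g ` S)"
    by (rule sum_squared_le_sum_of_squares)
  then have "real ((card S)\<^sup>2) \<le> real (card (g ` S) * card {(s, t) \<in> S \<times> S. g s = g t})"
    by (simp only: 2) (simp add: 1 mult.commute)
  then show ?thesis
    by (simp only: of_nat_le_iff)
qed

context field
begin

section \<open>Dilates of sets\<close>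

lemma l_coset_eq_image: "d <# A = (\<lambda>x. d \<otimes> x) ` A"
  by (auto simp: l_coset_def)

lemma l_coset_subset [simp, intro]:
  "d \<in> carrier R \<Longrightarrow> A \<subseteq> carrier R \<Longrightarrow> d <# A \<subseteq> carrier R"
  by (auto simp: l_coset_eq_image)

lemma finite_l_coset [simp, intro]: "finite A \<Longrightarrow> finite (d <# A)"
  by (simp add: l_coset_eq_image)

lemma l_coset_eq_empty [simp]: "d <# A = {} \<longleftrightarrow> A = {}"
  by (simp add: l_coset_eq_image)

lemma l_coset_mono: "A \<subseteq> B \<Longrightarrow> d <# A \<subseteq> d <# B"
  by (auto simp: l_coset_eq_image)

lemma inj_on_mult_left:
  "d \<in> carrier R \<Longrightarrow> d \<noteq> \<zero> \<Longrightarrow> A \<subseteq> carrier R \<Longrightarrow> inj_on (\<lambda>x. d \<otimes> x) A"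
  by (intro inj_onI) (meson m_lcancel subsetD)

lemma card_l_coset:
  "d \<in> carrier R \<Longrightarrow> d \<noteq> \<zero> \<Longrightarrow> A \<subseteq> carrier R \<Longrightarrow> card (d <# A) = card A"
  by (simp add: l_coset_eq_image card_image inj_on_mult_left)

lemma l_coset_set_add:
  assumes "d \<in> carrier R" "A \<subseteq> carrier R" "B \<subseteq> carrier R"
  shows "d <# (A <+> B) = (d <# A) <+> (d <# B)"
proof -
  have "d <# (A <+> B) = (\<Union>a\<in>A. \<Union>b\<in>B. {d \<otimes> (a \<oplus> b)})"
    by (auto simp: l_coset_def set_add_def')
  also have "\<dots> = (\<Union>a\<in>A. \<Union>b\<in>B. {d \<otimes> a \<oplus> d \<otimes> b})"
    using assms by (intro SUP_cong refl) (simp add: r_distr subset_iff)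
  also have "\<dots> = (d <# A) <+> (d <# B)"
    by (auto simp: l_coset_def set_add_def')
  finally show ?thesis .
qed

section \<open>Lower bounds for sums of two dilates\<close>

text \<open>Pluennecke is applied to \<open>d <# A\<close> with the summands \<open>d <# A\<close>
  and \<open>e <# A\<close>. For the resulting \<open>X\<close> inside \<open>d <# A\<close>, the
  sums of \<open>x\<close> in \<open>X\<close> and \<open>(d + e) r\<close> with \<open>r\<close> in
  \<open>A\<close> are pairwise distinct. They lie in the triple sumset because
  \<open>(d + e) r = d r + e r\<close>, so \<open>card X\<close> cancels.\<close>

lemma card_cube_le_if_unique_sums:
  assumes A: "A \<subseteq> carrier R" "finite A" "A \<noteq> {}"
    and d: "d \<in> carrier R" "d \<noteq> \<zero>" and e: "e \<in> carrier R"
    and unique: "\<And>s s' r r'. s \<in> A \<Longrightarrow> s' \<in> A \<Longrightarrow> r \<in> A \<Longrightarrow> r' \<in> A \<Longrightarrow>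
      d \<otimes> s \<oplus> (d \<oplus> e) \<otimes> r = d \<otimes> s' \<oplus> (d \<oplus> e) \<otimes> r' \<Longrightarrow> s = s' \<and> r = r'"
  shows "real (card A) ^ 3 \<le> 4 * real (card (A <+> A)) * real (card ((d <# A) <+> (e <# A)))"
proof -
  define n where "n = real (card A)"
  have n: "n > 0"
    using A by (simp add: n_def card_gt_0_iff)
  let ?Y = "d <# A" and ?B = "e <# A"
  have Y: "?Y \<subseteq> carrier R" "finite ?Y" "?Y \<noteq> {}" and B: "?B \<subseteq> carrier R" "finite ?B" "?B \<noteq> {}"
    using A d e by auto
  have cardY: "real (card ?Y) = n"
    using A d by (simp add: card_l_coset n_def)
  have "card (?Y <+> ?Y) = card (A <+> A)"
    using A d by (simp add: card_l_coset flip: l_coset_set_add)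
  then have 1: "real (card (?Y <+> ?Y)) \<le> (card (A <+> A) / n) * card ?Y"
    using n by (simp add: cardY)
  have 2: "real (card (?Y <+> ?B)) \<le> (card (?Y <+> ?B) / n) * card ?Y"
    using n by (simp add: cardY)
  obtain X where X: "X \<subseteq> ?Y" "X \<noteq> {}"
    "real (card (X <+> ?Y <+> ?B)) \<le> 4 * (card (A <+> A) / n) * (card (?Y <+> ?B) / n) * card X"
    by (rule pluennecke_two_summands[OF Y Y B 1 2])
  have Xc: "X \<subseteq> carrier R" "finite X" 
    using subset_trans[OF X(1) Y(1)] finite_subset[OF X(1) Y(2)] by auto
  then have posX: "real (card X) > 0"
    using X by (simp add: card_gt_0_iff)
  have "inj_on (\<lambda>(x, r). x \<oplus> (d \<oplus> e) \<otimes> r) (X \<times> A)"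
  proof (rule inj_onI, clarify)
    fix x r x' r' assume *: "x \<in> X" "r \<in> A" "x' \<in> X" "r' \<in> A"
      and eq: "x \<oplus> (d \<oplus> e) \<otimes> r = x' \<oplus> (d \<oplus> e) \<otimes> r'"
    obtain s s' where s: "s \<in> A" "x = d \<otimes> s" "s' \<in> A" "x' = d \<otimes> s'"
      using * X(1) unfolding l_coset_eq_image by blast
    then show "x = x' \<and> r = r'"
      using unique[of s s' r r'] * eq by simp
  qed
  then have "card X * card A = card ((\<lambda>(x, r). x \<oplus> (d \<oplus> e) \<otimes> r) ` (X \<times> A))"
    by (simp add: card_image card_cartesian_product)
  also have "\<dots> \<le> card (X <+> ?Y <+> ?B)"
  proof (intro card_mono subsetI)
    show "finite (X <+> ?Y <+> ?B)"
      using Xc A by simp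
    fix z assume "z \<in> (\<lambda>(x, r). x \<oplus> (d \<oplus> e) \<otimes> r) ` (X \<times> A)"
    then obtain x r where z: "x \<in> X" "r \<in> A" "z = x \<oplus> (d \<oplus> e) \<otimes> r"
      by auto
    have "z = x \<oplus> d \<otimes> r \<oplus> e \<otimes> r"
      using z d e A Xc by (simp add: l_distr a_assoc subset_iff)
    moreover have "d \<otimes> r \<in> ?Y" "e \<otimes> r \<in> ?B"
      using z by (auto simp: l_coset_eq_image)
    ultimately show "z \<in> X <+> ?Y <+> ?B"
      using z(1) by (simp add: set_addI)
  qed
  finally have "real (card X) * n \<le> card (X <+> ?Y <+> ?B)"
    unfolding n_def of_nat_mult[symmetric] of_nat_le_iff .
  also have "\<dots> \<le> card X * (4 * (card (A <+> A) / n) * (card (?Y <+> ?B) / n))"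
    using X(3) by (simp add: mult_ac)
  finally have "n \<le> 4 * (card (A <+> A) / n) * (card (?Y <+> ?B) / n)"
    using posX by (rule mult_left_le_imp_le)
  then show ?thesis
    using n by (simp add: n_def[symmetric] field_simps power3_eq_cube)
qed

text \<open>An average over all nonzero \<open>x\<close>. A pair of equal points of
  \<open>A \<times> A\<close> collides for every \<open>x\<close>, and a pair of different points
  for at most one \<open>x\<close>, the quotient \<open>(u - v) / (s - r)\<close>. The total is at
  most \<open>card F * card P + card P * card P\<close>, and the second term does not exceed the
  first.\<close>

lemma obtain_dilation_few_collisions:
  assumes fin: "finite (carrier R)" and A: "A \<subseteq> carrier R" and small: "(card A)\<^sup>2 < card (carrier R)"
  obtains x where "x \<in> carrier R" "x \<noteq> \<zero>"
    "card {((u, r), (v, s)) \<in> (A \<times> A) \<times> (A \<times> A). u \<oplus> x \<otimes> r = v \<oplus> x \<otimes> s} \<le> 2 * (card A)\<^sup>2"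
proof -
  define F where "F = carrier R - {\<zero>}"
  define E where
    "E x = {((u, r), (v, s)) \<in> (A \<times> A) \<times> (A \<times> A). u \<oplus> x \<otimes> r = v \<oplus> x \<otimes> s}" for x
  define P where "P = A \<times> A"
  have finA: "finite A" and finP: "finite P" and finF: "finite F"
    using A fin by (auto simp: P_def F_def intro: finite_subset)
  have cardF: "card F = card (carrier R) - 1"
    using fin by (simp add: F_def)
  have cardP: "card P = (card A)\<^sup>2"
    by (simp add: P_def card_cartesian_product power2_eq_square)
  \<comment> \<open>The strict inequality in \<open>small\<close> compensates for the removal of
    zero from the field.\<close>
  have PF: "card P \<le> card F"
    using small by (simp add: cardF cardP)
  have Fpos: "card F > 0" 
  proof -
    have "\<one> \<in> F" by (simp add: F_def)
    then show ?thesis using finF card_gt_0_iff by blast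
  qed
  have "\<exists>x\<in>F. card (E x) \<le> 2 * card P"
  proof (rule ccontr)
    assume "\<not> ?thesis"
    then have "(\<Sum>x\<in>F. 2 * card P) < (\<Sum>x\<in>F. card (E x))"
      using Fpos finF by (intro sum_strict_mono) (auto simp: not_le)
    moreover have "(\<Sum>x\<in>F. card (E x)) \<le> card F * card P + card P * card P"
    proof -
      have "(\<Sum>x\<in>F. card (E x)) = (\<Sum>x\<in>F. \<Sum>w\<in>P \<times> P. if w \<in> E x then 1 else 0)"
      proof (rule sum.cong[OF refl])
        fix x
        have "E x = {w \<in> P \<times> P. w \<in> E x}"
          by (auto simp: E_def P_def)
        then show "card (E x) = (\<Sum>w\<in>P \<times> P. if w \<in> E x then 1 else 0)"
          using finP by (simp add: sum.If_cases Int_def)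
      qed
      also have "\<dots> = (\<Sum>w\<in>P \<times> P. \<Sum>x\<in>F. if w \<in> E x then 1 else 0)"
        by (rule sum.swap)
      also have "\<dots> = (\<Sum>w\<in>P \<times> P. card {x \<in> F. w \<in> E x})"
        using finF by (simp add: sum.If_cases Int_def)
      also have "\<dots> \<le> (\<Sum>w\<in>P \<times> P. (if fst w = snd w then card F else 0) + 1)"
      proof (rule sum_mono)
        fix w assume "w \<in> P \<times> P"
        then obtain u r v s where w: "w = ((u, r), (v, s))" "u \<in> A" "r \<in> A" "v \<in> A" "s \<in> A"
          by (auto simp: P_def)
        then have wc: "u \<in> carrier R" "r \<in> carrier R" "v \<in> carrier R" "s \<in> carrier R"
          using A by auto
        show "card {x \<in> F. w \<in> E x} \<le> (if fst w = snd w then card F else 0) + 1"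
        proof (cases "fst w = snd w")
          case True
          then show ?thesis
            using card_mono[OF finF, of "{x \<in> F. w \<in> E x}"] by auto
        next
          case False
          have sub: "u \<ominus> v = x \<otimes> (s \<ominus> r)" if "x \<in> F" "w \<in> E x" for x
          proof -
            have x: "x \<in> carrier R" "u \<oplus> x \<otimes> r = v \<oplus> x \<otimes> s"
              using that w by (auto simp: F_def E_def)
            then have "u = v \<oplus> x \<otimes> s \<ominus> x \<otimes> r"
              using wc by (metis add.inv_solve_right a_minus_def m_closed a_closed)
            then show ?thesis
              using wc x(1) by algebra
          qed
          have "x = y" if "x \<in> F" "w \<in> E x" "y \<in> F" "w \<in> E y" for x y
          proof (cases "s = r")
            case True
            then have "u \<ominus> v = \<zero>"
              using sub[OF that(1,2)] that(1) wc by (simp add: F_def r_neg a_minus_def)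
            then have "u = v"
              using wc by simp
            then show ?thesis
              using False True w by simp
          next
            case neq: False
            then have "s \<ominus> r \<noteq> \<zero>" "s \<ominus> r \<in> carrier R"
              using wc by auto
            then show ?thesis
              using sub[OF that(1,2)] sub[OF that(3,4)] that(1,3)
              by (metis F_def DiffD1 m_rcancel)
          qed
          then have "card {x \<in> F. w \<in> E x} \<le> 1"
            using finF by (auto simp: card_le_Suc0_iff_eq)
          then show ?thesis using False by simp
        qed
      qed
      also have "\<dots> = (\<Sum>w\<in>P \<times> P. if fst w = snd w then card F else 0) + card P * card P"
        by (simp only: sum.distrib) (simp add: card_cartesian_product)
      also have "(\<Sum>w\<in>P \<times> P. if fst w = snd w then card F else 0)
          = (\<Sum>a\<in>P. \<Sum>b\<in>P. if a = b then card F else 0)"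
        by (simp add: sum.cartesian_product split_beta)
      also have "\<dots> = card F * card P"
        using finP by simp
      finally show ?thesis .
    qed
    moreover have "card P * card P \<le> card F * card P"
      using PF by simp
    ultimately show False by simp
  qed
  then show ?thesis
    using that by (auto simp: F_def E_def cardP)
qed


text \<open>Either the quotients \<open>(u - v) / (x - y)\<close> of differences of \<open>A\<close> are not closed under adding
  one, or they exhaust the field; the hypothesis \<open>generated\<close> says that the field is prime.\<close>

lemma large_sum_of_dilates:
  fixes M :: real
  assumes fin: "finite (carrier R)"
    and generated: "\<And>Q. \<zero> \<in> Q \<Longrightarrow> (\<And>q. q \<in> carrier R \<Longrightarrow> q \<in> Q \<Longrightarrow> q \<oplus> \<one> \<in> Q) \<Longrightarrow> carrier R \<subseteq> Q"
    and A: "A \<subseteq> carrier R" and two: "2 \<le> card A" and small: "(card A)\<^sup>2 < card (carrier R)"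
    and M: "card (A <+> A) \<le> M"
  obtains x y u v where "x \<in> A" "y \<in> A" "u \<in> A" "v \<in> A"
    "\<And>B. B \<subseteq> A \<Longrightarrow> card A \<le> 2 * card B \<Longrightarrow>
      real (card A) ^ 3 \<le> 32 * M * card (((x \<ominus> y) <# B) <+> ((u \<ominus> v) <# B))"
proof -
  \<comment> \<open>The quotients of differences, with the division multiplied out.\<close>
  define Q where "Q = {q \<in> carrier R. \<exists>x\<in>A. \<exists>y\<in>A. \<exists>u\<in>A. \<exists>v\<in>A. x \<noteq> y \<and> q \<otimes> (x \<ominus> y) = u \<ominus> v}"
  define n where "n = real (card A)"
  have finA: "finite A" and n: "n \<ge> 2"
    using two by (auto simp: n_def intro: card_ge_0_finite)
  obtain a b where ab: "a \<in> A" "b \<in> A" "a \<noteq> b"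
    using two card_le_Suc0_iff_eq[OF finA] by fastforce
  have AM: "n \<le> M"
    using card_le_card_set_add[OF A A finA finA] ab(1) M by (force simp: n_def)
  have zero: "\<zero> \<in> Q"
  proof -
    have "\<zero> \<otimes> (a \<ominus> b) = a \<ominus> a"
      using ab A by (simp add: subset_iff r_neg a_minus_def)
    then show ?thesis
      using ab unfolding Q_def by blast
  qed
  show thesis
  proof (cases "\<exists>q\<in>Q. q \<oplus> \<one> \<notin> Q")
    case True
    then obtain q x y u v where q: "q \<in> carrier R" "q \<oplus> \<one> \<notin> Q"
      and xy: "x \<in> A" "y \<in> A" "u \<in> A" "v \<in> A" "x \<noteq> y" "q \<otimes> (x \<ominus> y) = u \<ominus> v"
      by (auto simp: Q_def)
    have xyc: "x \<in> carrier R" "y \<in> carrier R" "u \<in> carrier R" "v \<in> carrier R"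
      using xy A by auto
    define d e where "d = x \<ominus> y" and "e = u \<ominus> v"
    have d: "d \<in> carrier R" "d \<noteq> \<zero>" and e: "e \<in> carrier R"
      using xyc xy(5) by (auto simp: d_def e_def)
    \<comment> \<open>As \<open>e = q d\<close>, the dilation factor \<open>d + e\<close> is
      \<open>d\<close> times the non-quotient \<open>q + 1\<close>.\<close>
    have de: "d \<oplus> e = d \<otimes> (q \<oplus> \<one>)"
      using d q xy(6) xyc unfolding d_def[symmetric] e_def[symmetric]
      by (metis r_distr one_closed r_one m_comm a_comm m_closed)
    have unique: "s = s' \<and> r = r'"
      if S: "s \<in> A" "s' \<in> A" "r \<in> A" "r' \<in> A"
        and eq: "d \<otimes> s \<oplus> (d \<oplus> e) \<otimes> r = d \<otimes> s' \<oplus> (d \<oplus> e) \<otimes> r'" for s s' r r'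
    proof -
      have Sc: "s \<in> carrier R" "s' \<in> carrier R" "r \<in> carrier R" "r' \<in> carrier R"
        using S A by auto
      define k where "k = q \<oplus> \<one>"
      have k: "k \<in> carrier R" using q by (simp add: k_def)
      have "d \<otimes> (s \<oplus> k \<otimes> r) = d \<otimes> (s' \<oplus> k \<otimes> r')"
        using eq d k Sc by (simp add: de k_def[symmetric] r_distr m_assoc)
      then have eq': "s \<oplus> k \<otimes> r = s' \<oplus> k \<otimes> r'"
        using d k Sc by (simp add: m_lcancel)
      \<comment> \<open>Otherwise \<open>k\<close> would be the quotient
        \<open>(s - s') / (r' - r)\<close>, contrary to the choice of \<open>q\<close>.\<close>
      have "r = r'"
      proof (rule ccontr)
        assume neq: "r \<noteq> r'"
        have "s = s' \<oplus> k \<otimes> r' \<ominus> k \<otimes> r"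
          using eq' k Sc by (metis add.inv_solve_right a_minus_def m_closed a_closed)
        then have "k \<otimes> (r' \<ominus> r) = s \<ominus> s'"
          using k Sc by algebra
        then have "k \<in> Q"
          using neq S k unfolding Q_def
          by (intro CollectI conjI bexI[of _ r'] bexI[of _ r] bexI[of _ s] bexI[of _ s']) auto
        then show False using q by (simp add: k_def)
      qed
      then show ?thesis
        using eq' k Sc by simp
    qed
    show thesis
    proof (rule that[OF xy(1-4)])
      fix B assume B: "B \<subseteq> A" "card A \<le> 2 * card B"
      have Bc: "B \<subseteq> carrier R" "finite B" "B \<noteq> {}"
        using B A finite_subset[OF B(1) finA] two by auto
      define D where "D = real (card ((d <# B) <+> (e <# B)))"
      have "card (B <+> B) \<le> card (A <+> A)"
        using B(1) finA by (intro card_mono set_add_mono) auto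
      then have BM: "real (card (B <+> B)) \<le> M"
        using M by linarith
      \<comment> \<open>Passing to \<open>B\<close> costs \<open>2 ^ 3\<close>, which with the 4
        from Pluennecke makes 32.\<close>
      have "n ^ 3 \<le> (2 * real (card B)) ^ 3"
        using B(2) n by (intro power_mono) (auto simp: n_def)
      also have "\<dots> = 8 * real (card B) ^ 3"
        by (simp add: power_mult_distrib)
      also have "real (card B) ^ 3 \<le> 4 * real (card (B <+> B)) * D"
        unfolding D_def using B(1)
        by (intro card_cube_le_if_unique_sums[OF Bc d e(1)]) (meson unique subsetD)
      also have "\<dots> \<le> 4 * M * D"
        using BM by (intro mult_right_mono) (auto simp: D_def)
      finally show "real (card A) ^ 3 \<le> 32 * M * card (((x \<ominus> y) <# B) <+> ((u \<ominus> v) <# B))"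
        by (simp add: n_def D_def d_def e_def)
    qed
  next
    case False
    then have QR: "carrier R \<subseteq> Q"
      using zero by (intro generated) auto
    obtain \<xi> where \<xi>: "\<xi> \<in> carrier R" "\<xi> \<noteq> \<zero>"
      and few: "card {((u, r), (v, s)) \<in> (A \<times> A) \<times> (A \<times> A). u \<oplus> \<xi> \<otimes> r = v \<oplus> \<xi> \<otimes> s} \<le> 2 * (card A)\<^sup>2"
      by (rule obtain_dilation_few_collisions[OF fin A small])
    \<comment> \<open>The dilation \<open>\<xi>\<close> was found by averaging, with no regard to
      differences of \<open>A\<close>. Since the quotients exhaust the field, it is nevertheless one
      of them.\<close>
    obtain x y u v where xy: "x \<in> A" "y \<in> A" "u \<in> A" "v \<in> A" "x \<noteq> y" "\<xi> \<otimes> (x \<ominus> y) = u \<ominus> v"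
      using QR \<xi>(1) by (auto simp: Q_def subset_iff)
    have xyc: "x \<in> carrier R" "y \<in> carrier R" "u \<in> carrier R" "v \<in> carrier R"
      using xy A by auto
    define d e where "d = x \<ominus> y" and "e = u \<ominus> v"
    have d: "d \<in> carrier R" "d \<noteq> \<zero>" and e: "e = \<xi> \<otimes> d" "e \<in> carrier R"
      using xyc xy(5,6) by (auto simp: d_def e_def)
    show thesis
    proof (rule that[OF xy(1-4)])
      fix B assume B: "B \<subseteq> A" "card A \<le> 2 * card B"
      have Bc: "B \<subseteq> carrier R" "finite B" "B \<noteq> {}"
        using B A finite_subset[OF B(1) finA] two by auto
      define D where "D = real (card ((d <# B) <+> (e <# B)))"
      define g where "g = (\<lambda>(s, r). d \<otimes> s \<oplus> e \<otimes> r)"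
      have img: "g ` (B \<times> B) = (d <# B) <+> (e <# B)"
        by (auto simp: g_def set_add_def' l_coset_def)
      \<comment> \<open>Since \<open>e = \<xi> d\<close>, cancelling \<open>d\<close> turns a
        collision of \<open>g\<close> into one counted in \<open>few\<close>.\<close>
      have "{(s, t) \<in> (B \<times> B) \<times> (B \<times> B). g s = g t}
          \<subseteq> {((u, r), (v, s)) \<in> (A \<times> A) \<times> (A \<times> A). u \<oplus> \<xi> \<otimes> r = v \<oplus> \<xi> \<otimes> s}"
      proof
        fix w assume "w \<in> {(s, t) \<in> (B \<times> B) \<times> (B \<times> B). g s = g t}"
        then obtain u r v s where w: "w = ((u, r), (v, s))"
          and S: "u \<in> B" "r \<in> B" "v \<in> B" "s \<in> B" and eq: "g (u, r) = g (v, s)"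
          by auto
        have Sc: "u \<in> carrier R" "r \<in> carrier R" "v \<in> carrier R" "s \<in> carrier R"
          using S Bc by auto
        have "d \<otimes> (u \<oplus> \<xi> \<otimes> r) = d \<otimes> (v \<oplus> \<xi> \<otimes> s)"
          using eq Sc d \<xi> by (simp add: g_def e r_distr m_ac)
        then have "u \<oplus> \<xi> \<otimes> r = v \<oplus> \<xi> \<otimes> s"
          using Sc d \<xi> by (simp add: m_lcancel)
        then show "w \<in> {((u, r), (v, s)) \<in> (A \<times> A) \<times> (A \<times> A). u \<oplus> \<xi> \<otimes> r = v \<oplus> \<xi> \<otimes> s}"
          using S B w by auto
      qed
      then have "card {(s, t) \<in> (B \<times> B) \<times> (B \<times> B). g s = g t}
          \<le> card {((u, r), (v, s)) \<in> (A \<times> A) \<times> (A \<times> A). u \<oplus> \<xi> \<otimes> r = v \<oplus> \<xi> \<otimes> s}"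
        using finA by (intro card_mono) (auto intro: finite_subset[of _ "(A \<times> A) \<times> (A \<times> A)"])
      also note few
      finally have coll: "card {(s, t) \<in> (B \<times> B) \<times> (B \<times> B). g s = g t} \<le> 2 * (card A)\<^sup>2" .
      have "(card (B \<times> B))\<^sup>2 \<le> card (g ` (B \<times> B)) * card {(s, t) \<in> (B \<times> B) \<times> (B \<times> B). g s = g t}"
        using Bc by (intro card_squared_le_collisions) auto
      also have "\<dots> \<le> card (g ` (B \<times> B)) * (2 * (card A)\<^sup>2)"
        using coll by (rule mult_left_mono) simp
      finally have "real ((card (B \<times> B))\<^sup>2) \<le> real (card (g ` (B \<times> B)) * (2 * (card A)\<^sup>2))"
        by (simp only: of_nat_le_iff)
      then have B4: "real (card B) ^ 4 \<le> D * (2 * n\<^sup>2)"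
        by (simp add: img D_def n_def card_cartesian_product power2_eq_square power4_eq_xxxx mult_ac)
      have "n ^ 4 \<le> (2 * real (card B)) ^ 4"
        using B(2) n by (intro power_mono) (auto simp: n_def)
      also have "\<dots> = 16 * real (card B) ^ 4"
        by (simp add: power_mult_distrib)
      also have "\<dots> \<le> 32 * D * n\<^sup>2"
        using B4 by simp
      finally have "n\<^sup>2 * n\<^sup>2 \<le> n\<^sup>2 * (32 * D)"
        by (simp add: power4_eq_xxxx power2_eq_square mult_ac)
      then have "n\<^sup>2 \<le> 32 * D"
        by (rule mult_left_le_imp_le) (use n in simp)
      \<comment> \<open>This case yields the bound without \<open>M\<close>, but with one power of
        \<open>n\<close> less; \<open>n <= M\<close> brings it to the form of the first
        case.\<close>
      then have "n * n\<^sup>2 \<le> M * (32 * D)"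
        by (rule mult_mono[OF AM]) (use AM n in auto)
      then show "real (card A) ^ 3 \<le> 32 * M * card (((x \<ominus> y) <# B) <+> ((u \<ominus> v) <# B))"
        unfolding n_def D_def d_def e_def by (simp add: power3_eq_cube power2_eq_square mult_ac)
    qed
  qed
qed


section \<open>Upper bounds for sums of two dilates\<close>

text \<open>The covering lemma is applied to \<open>a <# A1\<close> and the large set
  \<open>(a <# A) \<inter> E\<close>. The proportion 1/8 is chosen so that four exceptional sets
  together still miss at least half of \<open>A1\<close>.\<close>

lemma cover_dilate:
  fixes M :: real and N :: nat
  assumes A: "A \<subseteq> carrier R" "finite A" and A1: "A1 \<subseteq> A" "A1 \<noteq> {}"
    and a: "a \<in> carrier R" "a \<noteq> \<zero>" and N: "N > 0" "N \<le> card ((a <# A) \<inter> E)"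
    and M: "card (A <+> A) \<le> M"
  obtains T C where "T \<subseteq> carrier R" "finite T" "card T \<le> 8 * M / N"
    "C \<subseteq> A1" "8 * card (A1 - C) \<le> card A1" "\<forall>c\<in>C. a \<otimes> c \<in> T <+> a_inv R ` E"
proof -
  have A1c: "A1 \<subseteq> carrier R" "finite A1"
    using A A1 finite_subset[OF A1(1) A(2)] by auto
  let ?D = "(a <# A) \<inter> E"
  have D: "?D \<subseteq> carrier R" "finite ?D" "?D \<noteq> {}"
    using A a N by (auto simp: le_Suc_eq dest: l_coset_subset)
  have X: "a <# A1 \<subseteq> carrier R" "finite (a <# A1)" "a <# A1 \<noteq> {}"
    using A1c A1 a by auto
  obtain T where T: "T \<subseteq> carrier R" "finite T" 
      "real (card T) \<le> card ((a <# A1) <+> ?D) / (1 / 8 * card ?D)"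
      "real (card ((a <# A1) - (T <+> a_inv R ` ?D))) \<le> 1 / 8 * card (a <# A1)"
    by (rule covering_by_translates[OF X D, of "1 / 8"]) auto
  define C where "C = {c \<in> A1. a \<otimes> c \<in> T <+> a_inv R ` E}"
  \<comment> \<open>Both summands lie in \<open>a <# A\<close>, so the sumset in the covering bound
    is controlled by \<open>M\<close>.\<close>
  have "(a <# A1) <+> ?D \<subseteq> a <# (A <+> A)"
    unfolding l_coset_set_add[OF a(1) A(1) A(1)] by (intro set_add_mono l_coset_mono A1) auto
  then have "card ((a <# A1) <+> ?D) \<le> card (a <# (A <+> A))"
    using A by (intro card_mono) auto
  also have "\<dots> = card (A <+> A)"
    using a A by (simp add: card_l_coset)
  finally have sumM: "real (card ((a <# A1) <+> ?D)) \<le> M"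
    using M by linarith
  have "real (card T) \<le> 8 * (card ((a <# A1) <+> ?D) / card ?D)"
    using T(3) by (simp add: mult.commute)
  also have "\<dots> \<le> 8 * (M / N)"
    using N sumM by (intro mult_left_mono frac_le) auto
  finally have cardT: "card T \<le> 8 * M / N"
    by simp
  have "a <# (A1 - C) \<subseteq> (a <# A1) - (T <+> a_inv R ` ?D)"
  proof
    fix z assume "z \<in> a <# (A1 - C)"
    then obtain c where c: "c \<in> A1" "c \<notin> C" "z = a \<otimes> c"
      by (auto simp: l_coset_eq_image)
    have "T <+> a_inv R ` ?D \<subseteq> T <+> a_inv R ` E"
      by (intro set_add_mono) auto
    then show "z \<in> (a <# A1) - (T <+> a_inv R ` ?D)"
      using c by (auto simp: C_def l_coset_eq_image)
  qed
  then have "card (a <# (A1 - C)) \<le> card ((a <# A1) - (T <+> a_inv R ` ?D))"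
    using X by (intro card_mono) auto
  moreover have "card (a <# (A1 - C)) = card (A1 - C)"
    using A1c a by (intro card_l_coset) auto
  moreover have "card (a <# A1) = card A1"
    using A1c a by (intro card_l_coset) auto
  ultimately have "8 * card (A1 - C) \<le> card A1"
    using T(4) by linarith
  with T cardT show thesis
    by (intro that[of T C]) (auto simp: C_def)
qed

text \<open>\<open>B\<close> keeps those \<open>c\<close> for which all of \<open>x c\<close>,
  \<open>y c\<close>, \<open>u c\<close>, \<open>v c\<close> are covered. A sum
  \<open>(x - y) s + (u - v) t\<close> is then a combination of four translation parameters plus an
  element of \<open>2bA - 2bA\<close>. Counting the parameters gives \<open>K ^ 4\<close>, and
  Pluennecke with Ruzsa bounds the rest.\<close>

lemma sum_of_dilates_le:
  fixes M :: real and N :: nat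
  assumes A: "A \<subseteq> carrier R - {\<zero>}" "finite A" and b: "b \<in> A" and A1: "A1 \<subseteq> A" "A1 \<noteq> {}"
    and N: "N > 0" and popular: "\<And>a. a \<in> A1 \<Longrightarrow> N \<le> card ((a <# A) \<inter> (b <# A))"
    and M: "card (A <+> A) \<le> M"
    and xyuv: "x \<in> A1" "y \<in> A1" "u \<in> A1" "v \<in> A1"
  obtains B where "B \<subseteq> A1" "card A1 \<le> 2 * card B"
    "card (((x \<ominus> y) <# B) <+> ((u \<ominus> v) <# B)) * real N ^ 4 * real (card A) ^ 3 \<le> 2 ^ 16 * M ^ 8"
proof -
  have Ac: "A \<subseteq> carrier R" and bc: "b \<in> carrier R" "b \<noteq> \<zero>" and finA1: "finite A1"
    using A b finite_subset[OF A1(1) A(2)] by auto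
  let ?bA = "b <# A"
  have bA: "?bA \<subseteq> carrier R" "finite ?bA" "?bA \<noteq> {}"
    using Ac bc b A(2) by auto
  define K where "K = 8 * M / N"
  define covers where "covers a T C \<longleftrightarrow> T \<subseteq> carrier R \<and> finite T \<and> real (card T) \<le> K \<and> C \<subseteq> A1 \<and>
    8 * card (A1 - C) \<le> card A1 \<and> (\<forall>c\<in>C. \<exists>t\<in>T. \<exists>e\<in>?bA. a \<otimes> c = t \<ominus> e)" for a T C
  have "\<exists>T C. covers a T C" if a: "a \<in> A1" for a
  proof -
    have a': "a \<in> carrier R" "a \<noteq> \<zero>"
      using a A A1 by auto
    obtain T C where TC: "T \<subseteq> carrier R" "finite T" "card T \<le> 8 * M / N" 
      "C \<subseteq> A1" "8 * card (A1 - C) \<le> card A1" "\<forall>c\<in>C. a \<otimes> c \<in> T <+> a_inv R ` ?bA"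
      by (rule cover_dilate[OF Ac A(2) A1 a' N popular[OF a] M])
    have "\<exists>t\<in>T. \<exists>e\<in>?bA. a \<otimes> c = t \<ominus> e" if "c \<in> C" for c
      using TC(6) that by (auto simp: set_add_iff a_minus_def)
    with TC show ?thesis
      unfolding K_def covers_def by blast
  qed
  then obtain T C where "\<And>a. a \<in> A1 \<Longrightarrow> covers a (T a) (C a)"
    by metis
  then have T: "\<And>a. a \<in> A1 \<Longrightarrow> T a \<subseteq> carrier R" "\<And>a. a \<in> A1 \<Longrightarrow> finite (T a)"
      "\<And>a. a \<in> A1 \<Longrightarrow> real (card (T a)) \<le> K"
    and C: "\<And>a. a \<in> A1 \<Longrightarrow> C a \<subseteq> A1" "\<And>a. a \<in> A1 \<Longrightarrow> 8 * card (A1 - C a) \<le> card A1"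
    and TC: "\<And>a c. a \<in> A1 \<Longrightarrow> c \<in> C a \<Longrightarrow> \<exists>t\<in>T a. \<exists>e\<in>?bA. a \<otimes> c = t \<ominus> e"
    unfolding covers_def by auto
  define B where "B = C x \<inter> C y \<inter> C u \<inter> C v"
  have B: "B \<subseteq> A1"
    using C(1) xyuv by (auto simp: B_def)
  have "card (A1 - B) \<le> card ((A1 - C x) \<union> (A1 - C y) \<union> ((A1 - C u) \<union> (A1 - C v)))"
    using finA1 by (intro card_mono) (auto simp: B_def)
  also have "\<dots> \<le> (card (A1 - C x) + card (A1 - C y)) + (card (A1 - C u) + card (A1 - C v))"
    by (intro order_trans[OF card_Un_le] add_mono card_Un_le)
  finally have "2 * card (A1 - B) \<le> card A1"
    using C(2)[OF xyuv(1)] C(2)[OF xyuv(2)] C(2)[OF xyuv(3)] C(2)[OF xyuv(4)] by linarith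
  moreover have "card (A1 - B) = card A1 - card B"
    using B finA1 by (intro card_Diff_subset) (auto intro: finite_subset)
  ultimately have cardB: "card A1 \<le> 2 * card B"
    by linarith
  let ?T = "(T x <+> a_inv R ` T y) <+> (T u <+> a_inv R ` T v)"
  let ?E = "(?bA <+> ?bA) <+> a_inv R ` (?bA <+> ?bA)"
  have sub: "((x \<ominus> y) <# B) <+> ((u \<ominus> v) <# B) \<subseteq> ?T <+> ?E"
  proof
    fix z assume "z \<in> ((x \<ominus> y) <# B) <+> ((u \<ominus> v) <# B)"
    then obtain s t where st: "s \<in> B" "t \<in> B" "z = (x \<ominus> y) \<otimes> s \<oplus> (u \<ominus> v) \<otimes> t"
      by (auto simp: set_add_iff l_coset_eq_image)
    obtain t1 e1 where 1: "t1 \<in> T x" "e1 \<in> ?bA" "x \<otimes> s = t1 \<ominus> e1"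
      using TC[OF xyuv(1), of s] st by (auto simp: B_def)
    obtain t2 e2 where 2: "t2 \<in> T y" "e2 \<in> ?bA" "y \<otimes> s = t2 \<ominus> e2"
      using TC[OF xyuv(2), of s] st by (auto simp: B_def)
    obtain t3 e3 where 3: "t3 \<in> T u" "e3 \<in> ?bA" "u \<otimes> t = t3 \<ominus> e3"
      using TC[OF xyuv(3), of t] st by (auto simp: B_def)
    obtain t4 e4 where 4: "t4 \<in> T v" "e4 \<in> ?bA" "v \<otimes> t = t4 \<ominus> e4"
      using TC[OF xyuv(4), of t] st by (auto simp: B_def)
    have tc: "t1 \<in> carrier R" "t2 \<in> carrier R" "t3 \<in> carrier R" "t4 \<in> carrier R"
      "e1 \<in> carrier R" "e2 \<in> carrier R" "e3 \<in> carrier R" "e4 \<in> carrier R"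
      using 1(1,2) 2(1,2) 3(1,2) 4(1,2) T(1) xyuv bA(1) by blast+
    have xc: "x \<in> carrier R" "y \<in> carrier R" "u \<in> carrier R" "v \<in> carrier R" "s \<in> carrier R" "t \<in> carrier R"
      using xyuv st(1,2) B A1 Ac by blast+
    \<comment> \<open>Expanding the two products leaves four covered terms; regrouping separates the
      translation parameters from the elements of \<open>b <# A\<close>.\<close>
    have "z = (x \<otimes> s \<ominus> y \<otimes> s) \<oplus> (u \<otimes> t \<ominus> v \<otimes> t)"
      unfolding st(3) using xc by algebra
    also have "\<dots> = ((t1 \<ominus> e1) \<ominus> (t2 \<ominus> e2)) \<oplus> ((t3 \<ominus> e3) \<ominus> (t4 \<ominus> e4))"
      by (simp only: 1 2 3 4)
    also have "\<dots> = ((t1 \<oplus> \<ominus> t2) \<oplus> (t3 \<oplus> \<ominus> t4)) \<oplus> ((e2 \<oplus> e4) \<oplus> \<ominus> (e1 \<oplus> e3))"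
      using tc by algebra
    also have "\<dots> \<in> ?T <+> ?E"
      using 1 2 3 4 by (intro set_addI imageI) auto
    finally show "z \<in> ?T <+> ?E" .
  qed
  have finT: "finite (T x)" "finite (T y)" "finite (T u)" "finite (T v)"
    using T(2) xyuv by auto
  have K0: "K \<ge> 0"
    using T(3)[OF xyuv(1)] by (meson of_nat_0_le_iff order_trans)
  have neg: "card (a_inv R ` S) \<le> card S" if "finite S" for S
    using that by (rule card_image_le)
  have "card ?T \<le> (card (T x) * card (T y)) * (card (T u) * card (T v))"
    using finT by (intro order_trans[OF card_set_add_le] mult_mono neg order_refl) auto
  then have "real (card ?T) \<le> (real (card (T x)) * card (T y)) * (real (card (T u)) * card (T v))"
    by (simp only: of_nat_mult[symmetric] of_nat_le_iff)
  also have "\<dots> \<le> (K * K) * (K * K)"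
    using T(3) xyuv K0 by (intro mult_mono) auto
  finally have cardT: "real (card ?T) \<le> K ^ 4"
    by (simp add: power4_eq_xxxx mult_ac)
  define D where "D = real (card (((x \<ominus> y) <# B) <+> ((u \<ominus> v) <# B)))"
  have "card (((x \<ominus> y) <# B) <+> ((u \<ominus> v) <# B)) \<le> card (?T <+> ?E)"
    using sub finT bA by (intro card_mono) auto
  also have "\<dots> \<le> card ?T * card ?E"
    using finT bA by (intro card_set_add_le) auto
  finally have "D \<le> real (card ?T) * card ?E"
    unfolding D_def of_nat_mult[symmetric] of_nat_le_iff .
  also have "\<dots> \<le> K ^ 4 * card ?E"
    using cardT by (intro mult_right_mono) auto
  finally have D: "D \<le> K ^ 4 * card ?E" .
  \<comment> \<open>Dilation by the nonzero \<open>b\<close> is injective and commutes with sums, so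
    the bound \<open>M\<close> carries over to \<open>b <# A\<close>.\<close>
  have "card (?bA <+> ?bA) = card (A <+> A)"
    using bc Ac by (simp add: card_l_coset flip: l_coset_set_add)
  then have "real (card (?bA <+> ?bA)) \<le> M"
    using M by simp
  then have "card ?E * real (card ?bA) ^ 3 \<le> 16 * M ^ 4"
    using bA by (intro card_double_difference_le)
  then have E: "card ?E * real (card A) ^ 3 \<le> 16 * M ^ 4"
    using bc Ac by (simp add: card_l_coset)
  have "D * real N ^ 4 * real (card A) ^ 3 \<le> (K ^ 4 * card ?E) * real N ^ 4 * real (card A) ^ 3"
    using D by (intro mult_right_mono) auto
  also have "\<dots> = (K * N) ^ 4 * (card ?E * real (card A) ^ 3)"
    by (simp add: power_mult_distrib mult_ac)
  also have "\<dots> \<le> (K * N) ^ 4 * (16 * M ^ 4)"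
    using E by (intro mult_left_mono) auto
  \<comment> \<open>The choice of \<open>K\<close> absorbs the powers of \<open>N\<close>, and
    \<open>8 ^ 4 * 16 = 2 ^ 16\<close>.\<close>
  also have "K * N = 8 * M"
    using N by (simp add: K_def)
  also have "(8 * M) ^ 4 * (16 * M ^ 4) = 2 ^ 16 * M ^ 8"
    by (simp add: power_mult_distrib flip: power_add)
  finally show thesis
    using that[OF B cardB] by (simp add: D_def)
qed

section \<open>Multiplicative energy and a popular dilate\<close>

text \<open>Cauchy-Schwarz for the product map bounds the number of solutions of
  \<open>a x = b y\<close> from below. Sorting the solutions by \<open>(a, b)\<close> bounds this
  number above by the sizes of the intersections of dilates, and some \<open>b\<close> attains at
  least the average.\<close>

lemma exists_popular_dilate:
  assumes A: "A \<subseteq> carrier R - {\<zero>}" "finite A" "A \<noteq> {}"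
  obtains b where "b \<in> A" "card A ^ 3 \<le> card (A <#> A) * (\<Sum>a\<in>A. card ((a <# A) \<inter> (b <# A)))"
proof -
  define n where "n = card A"
  define g where "g = (\<lambda>(a, x). a \<otimes> x)"
  define f where "f a b = card ((a <# A) \<inter> (b <# A))" for a b
  have img: "g ` (A \<times> A) = A <#> A"
    by (auto simp: g_def set_mult_def)
  define S where "S = (SIGMA q:A \<times> A. {(x, y) \<in> A \<times> A. fst q \<otimes> x = snd q \<otimes> y})"
  \<comment> \<open>The common value \<open>a x = b y\<close> lies in both dilates and determines
    \<open>x\<close> and \<open>y\<close>, because \<open>a\<close> and \<open>b\<close> are
    nonzero.\<close>
  have fib: "card {(x, y) \<in> A \<times> A. a \<otimes> x = b \<otimes> y} \<le> f a b" if ab: "a \<in> A" "b \<in> A" for a b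
    unfolding f_def
  proof (rule card_inj_on_le)
    have "x = x'" if "c \<in> A" "x \<in> A" "x' \<in> A" "c \<otimes> x = c \<otimes> x'" for c x x'
      using that A(1) m_lcancel[of c x x'] by auto
    then show "inj_on (\<lambda>(x, y). a \<otimes> x) {(x, y) \<in> A \<times> A. a \<otimes> x = b \<otimes> y}"
      using ab by (auto simp: inj_on_def)
    show "(\<lambda>(x, y). a \<otimes> x) ` {(x, y) \<in> A \<times> A. a \<otimes> x = b \<otimes> y} \<subseteq> (a <# A) \<inter> (b <# A)"
      by (auto simp: l_coset_eq_image)
    show "finite ((a <# A) \<inter> (b <# A))"
      using A by auto
  qed
  have finS: "finite S"
    using A by (auto simp: S_def intro!: finite_SigmaI intro: finite_subset[of _ "A \<times> A"])
  have "{(s, t) \<in> (A \<times> A) \<times> (A \<times> A). g s = g t} \<subseteq> (\<lambda>((a, b), (x, y)). ((a, x), (b, y))) ` S"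
  proof
    fix w assume "w \<in> {(s, t) \<in> (A \<times> A) \<times> (A \<times> A). g s = g t}"
    then obtain a x b y where "w = ((a, x), (b, y))" "((a, b), (x, y)) \<in> S"
      by (auto simp: S_def g_def)
    then show "w \<in> (\<lambda>((a, b), (x, y)). ((a, x), (b, y))) ` S"
      by (intro rev_image_eqI[of "((a, b), (x, y))"]) auto
  qed
  then have "card {(s, t) \<in> (A \<times> A) \<times> (A \<times> A). g s = g t} \<le> card S"
    using finS by (rule surj_card_le[rotated])
  also have "\<dots> = (\<Sum>q\<in>A \<times> A. card {(x, y) \<in> A \<times> A. fst q \<otimes> x = snd q \<otimes> y})"
    unfolding S_def using A by (intro card_SigmaI) (auto intro: finite_subset[of _ "A \<times> A"])
  also have "\<dots> \<le> (\<Sum>q\<in>A \<times> A. f (fst q) (snd q))"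
    using fib by (intro sum_mono) auto
  also have "\<dots> = (\<Sum>a\<in>A. \<Sum>b\<in>A. f a b)"
    by (simp add: sum.cartesian_product split_beta)
  also have "\<dots> = (\<Sum>b\<in>A. \<Sum>a\<in>A. f a b)"
    by (rule sum.swap)
  finally have coll: "card {(s, t) \<in> (A \<times> A) \<times> (A \<times> A). g s = g t} \<le> (\<Sum>b\<in>A. \<Sum>a\<in>A. f a b)" .
  have "(card (A \<times> A))\<^sup>2 \<le> card (g ` (A \<times> A)) * card {(s, t) \<in> (A \<times> A) \<times> (A \<times> A). g s = g t}"
    using A by (intro card_squared_le_collisions) auto
  also have "\<dots> \<le> card (A <#> A) * (\<Sum>b\<in>A. \<Sum>a\<in>A. f a b)"
    unfolding img using coll by (rule mult_left_mono) simp
  finally have total: "n * n ^ 3 \<le> (\<Sum>b\<in>A. card (A <#> A) * (\<Sum>a\<in>A. f a b))"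
    by (simp add: n_def card_cartesian_product power2_eq_square power3_eq_cube sum_distrib_left mult_ac)
  have "\<exists>b\<in>A. n ^ 3 \<le> card (A <#> A) * (\<Sum>a\<in>A. f a b)"
  proof (rule ccontr)
    assume "\<not> ?thesis"
    then have "(\<Sum>b\<in>A. card (A <#> A) * (\<Sum>a\<in>A. f a b)) < (\<Sum>b\<in>A. n ^ 3)"
      using A by (intro sum_strict_mono) (auto simp: not_le)
    with total show False
      by (simp add: n_def)
  qed
  then show thesis
    using that by (auto simp: n_def f_def)
qed

end

section \<open>The sum-product estimate\<close>

lemma sum_inverse_le_ln:
  assumes "n \<ge> 1"
  shows "(\<Sum>t=1..n. 1 / real t) \<le> 1 + ln (real n)"
  using assms
proof (induction n rule: dec_induct)
  case (step n)
  have "ln (real n / real (Suc n)) \<le> real n / real (Suc n) - 1"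
    using step.hyps by (intro ln_le_minus_one) auto
  then have "1 / real (Suc n) \<le> ln (real (Suc n)) - ln (real n)"
    using step.hyps by (simp add: ln_div field_simps)
  then show ?case
    using step.IH by simp
qed simp

text \<open>The sum of \<open>f\<close> is the sum of the sizes of its superlevel sets for
  \<open>t\<close> from 1 to \<open>n\<close>. If \<open>N\<close> maximises \<open>t * c t\<close>,
  then \<open>c t <= N * c N / t\<close>, and the harmonic sum costs only
  \<open>1 + ln n\<close>.\<close>

lemma popular_threshold:
  fixes f :: "'a \<Rightarrow> nat"
  assumes A: "finite A" and n: "n \<ge> 1" and f: "\<And>a. a \<in> A \<Longrightarrow> f a \<le> n"
  obtains N where "1 \<le> N" "N \<le> n"
    "real (\<Sum>a\<in>A. f a) \<le> N * real (card {a \<in> A. N \<le> f a}) * (1 + ln n)"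
proof -
  define c where "c t = real (card {a \<in> A. t \<le> f a})" for t
  have "(\<Sum>a\<in>A. f a) = (\<Sum>a\<in>A. \<Sum>t=1..n. if t \<le> f a then 1 else 0)"
  proof (rule sum.cong[OF refl])
    fix a assume "a \<in> A"
    then have "{1..n} \<inter> {t. t \<le> f a} = {1..f a}"
      using f[of a] by auto
    then show "f a = (\<Sum>t=1..n. if t \<le> f a then 1 else 0)"
      by (simp add: sum.If_cases)
  qed
  also have "\<dots> = (\<Sum>t=1..n. \<Sum>a\<in>A. if t \<le> f a then 1 else 0)"
    by (rule sum.swap)
  also have "\<dots> = (\<Sum>t=1..n. card {a \<in> A. t \<le> f a})"
    using A by (simp add: sum.If_cases Int_def)
  finally have sum: "real (\<Sum>a\<in>A. f a) = (\<Sum>t=1..n. c t)"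
    by (simp add: c_def)
  define h where "h t = real t * c t" for t
  have "Max (h ` {1..n}) \<in> h ` {1..n}"
    using n by (intro Max_in) auto
  then obtain N where N: "N \<in> {1..n}" "Max (h ` {1..n}) = h N"
    by blast
  have max: "t * c t \<le> N * c N" if "t \<in> {1..n}" for t
  proof -
    have "h t \<le> Max (h ` {1..n})"
      using that by (intro Max_ge) auto
    then show ?thesis
      unfolding N(2) h_def .
  qed
  have "(\<Sum>t=1..n. c t) \<le> (\<Sum>t=1..n. N * c N * (1 / real t))"
  proof (rule sum_mono)
    fix t assume t: "t \<in> {1..n}"
    then have "c t = t * c t * (1 / real t)"
      by simp
    also have "\<dots> \<le> N * c N * (1 / real t)"
      using max[OF t] by (intro mult_right_mono) auto
    finally show "c t \<le> N * c N * (1 / real t)" .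
  qed
  also have "\<dots> = N * c N * (\<Sum>t=1..n. 1 / real t)"
    by (simp add: sum_distrib_left)
  also have "\<dots> \<le> N * c N * (1 + ln n)"
    using sum_inverse_le_ln[OF n] by (intro mult_left_mono) (auto simp: c_def)
  finally show thesis
    using that[of N] N(1) sum by (simp add: c_def)
qed

text \<open>Write \<open>n ^ 14\<close> as \<open>(n ^ 3) ^ 3 * n ^ 3 * n ^ 2\<close>. The cube of
  \<open>popular\<close> produces \<open>m ^ 3 * N ^ 3\<close>, and the fourth factor
  \<open>N\<close> required by \<open>core\<close> comes from \<open>n ^ 2 <= M * N * L\<close>,
  which follows from \<open>popular\<close> and \<open>m <= n\<close>.\<close>

lemma sum_product_exponents:
  fixes n M m N L :: real
  assumes pos: "n > 0" "m > 0" "N \<ge> 0" "M \<ge> 0" "L \<ge> 0"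
    and popular: "n ^ 3 \<le> M * N * m * L" and mn: "m \<le> n"
    and core: "m ^ 3 * N ^ 4 * n ^ 3 \<le> 2 ^ 21 * M ^ 9"
  shows "n ^ 14 \<le> 2 ^ 21 * M ^ 13 * L ^ 4"
proof -
  have "n * n\<^sup>2 \<le> n * (M * N * L)"
  proof -
    have "n * n\<^sup>2 = n ^ 3"
      by (simp add: power2_eq_square power3_eq_cube)
    also have "\<dots> \<le> (M * N * L) * m"
      using popular by (simp add: mult_ac)
    also have "\<dots> \<le> (M * N * L) * n"
      using pos mn by (intro mult_left_mono) auto
    finally show ?thesis by (simp add: mult_ac)
  qed
  then have sq: "n\<^sup>2 \<le> M * N * L"
    using pos(1) by (rule mult_left_le_imp_le)
  have "n ^ 14 = (n ^ 3) ^ 3 * n ^ 3 * n\<^sup>2"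
    by (simp flip: power_mult power_add)
  also have "\<dots> \<le> (M * N * m * L) ^ 3 * n ^ 3 * (M * N * L)"
    using pos popular sq by (intro mult_mono power_mono) auto
  also have "\<dots> = (m ^ 3 * N ^ 4 * n ^ 3) * (M ^ 4 * L ^ 4)"
    by (simp add: power_mult_distrib power3_eq_cube power4_eq_xxxx mult_ac)
  also have "\<dots> \<le> (2 ^ 21 * M ^ 9) * (M ^ 4 * L ^ 4)"
    using core pos by (intro mult_right_mono) auto
  also have "\<dots> = 2 ^ 21 * (M ^ 9 * M ^ 4) * L ^ 4"
    by (simp only: mult_ac)
  also have "M ^ 9 * M ^ 4 = M ^ 13"
    by (simp flip: power_add)
  finally show ?thesis .
qed

section \<open>Assembly for sets without zero\<close>

lemma (in field) sum_product_nonzero: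
  fixes M :: real
  assumes fin: "finite (carrier R)"
    and generated: "\<And>Q. \<zero> \<in> Q \<Longrightarrow> (\<And>q. q \<in> carrier R \<Longrightarrow> q \<in> Q \<Longrightarrow> q \<oplus> \<one> \<in> Q) \<Longrightarrow> carrier R \<subseteq> Q"
    and A: "A \<subseteq> carrier R - {\<zero>}" "A \<noteq> {}" and small: "(card A)\<^sup>2 < card (carrier R)"
    and sums: "card (set_add R A A) \<le> M" and products: "card (A <#> A) \<le> M"
  shows "real (card A) ^ 14 \<le> 2 ^ 21 * M ^ 13 * (1 + ln (card A)) ^ 4"
proof -
  have Ac: "A \<subseteq> carrier R" and finA: "finite A"
    using A fin finite_subset[of A "carrier R"] by auto
  define n where "n = real (card A)"
  have n1: "card A \<ge> 1"
    using finA A by (simp add: Suc_le_eq card_gt_0_iff)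
  then have n: "n \<ge> 1"
    by (simp add: n_def)
  have nM: "n \<le> M"
    using card_le_card_set_add[OF Ac Ac finA finA A(2)] sums by (simp add: n_def)
  define L where "L = 1 + ln n"
  have L: "L \<ge> 1"
    using n by (simp add: L_def)
  obtain b where b: "b \<in> A"
    "card A ^ 3 \<le> card (A <#> A) * (\<Sum>a\<in>A. card ((a <# A) \<inter> (b <# A)))"
    by (rule exists_popular_dilate[OF A(1) finA A(2)])
  define f where "f a = card ((a <# A) \<inter> (b <# A))" for a
  have "f a \<le> card A" if "a \<in> A" for a
  proof -
    have "f a \<le> card (b <# A)"
      unfolding f_def using finA by (intro card_mono) auto
    also have "\<dots> = card A"
      using b A by (intro card_l_coset) auto
    finally show ?thesis .
  qed
  then obtain N where N: "1 \<le> N" "N \<le> card A"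
    "real (\<Sum>a\<in>A. f a) \<le> N * real (card {a \<in> A. N \<le> f a}) * (1 + ln (card A))"
    using popular_threshold[OF finA n1, of f] by blast
  define A1 where "A1 = {a \<in> A. N \<le> f a}"
  define m where "m = real (card A1)"
  have A1: "A1 \<subseteq> A" "finite A1"
    using finA by (auto simp: A1_def)
  have "n ^ 3 \<le> real (card (A <#> A)) * real (\<Sum>a\<in>A. f a)"
    using b(2) unfolding n_def f_def of_nat_power[symmetric] of_nat_mult[symmetric] of_nat_le_iff .
  also have "\<dots> \<le> M * (N * m * L)"
    using products N(3) nM n
    by (intro mult_mono) (auto simp: m_def A1_def L_def n_def sum_nonneg)
  finally have popular: "n ^ 3 \<le> M * real N * m * L"
    by (simp add: mult_ac)
  have "m \<noteq> 0"
    using popular n by (auto simp: not_le)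
  then have m: "m \<ge> 1" and A1ne: "A1 \<noteq> {}"
    by (auto simp: m_def Suc_le_eq)
  have mn: "m \<le> n"
    using A1 finA by (simp add: m_def n_def card_mono)
  have core: "m ^ 3 * real N ^ 4 * n ^ 3 \<le> 2 ^ 21 * M ^ 9"
  proof (cases "card A1 \<ge> 2")
    \<comment> \<open>A single point offers no nonzero difference, but then
      \<open>N <= n <= M\<close> alone is enough.\<close>
    case False
    then have "m = 1"
      using m by (simp add: m_def)
    then have "m ^ 3 * real N ^ 4 * n ^ 3 = real N ^ 4 * n ^ 3"
      by simp
    also have "\<dots> \<le> n ^ 4 * n ^ 3"
      using N(2) by (intro mult_right_mono power_mono) (auto simp: n_def)
    also have "\<dots> = n ^ 7"
      by (simp flip: power_add)
    also have "\<dots> \<le> n ^ 9"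
      using n by (intro power_increasing) auto
    also have "\<dots> \<le> M ^ 9"
      using nM n by (intro power_mono) auto
    also have "\<dots> \<le> 2 ^ 21 * M ^ 9"
      using nM n by simp
    finally show ?thesis .
  next
    case True
    have "card A1 \<le> card A"
      using A1 finA by (simp add: card_mono)
    then have "(card A1)\<^sup>2 \<le> (card A)\<^sup>2"
      by (intro power_mono) auto
    then have small1: "(card A1)\<^sup>2 < card (carrier R)"
      using small by linarith
    have "card (set_add R A1 A1) \<le> card (set_add R A A)"
      using A1 finA by (intro card_mono set_add_mono) auto
    then have sums1: "card (set_add R A1 A1) \<le> M"
      using sums by linarith
    \<comment> \<open>The order of choices matters: the four elements are fixed first, and
      \<open>large\<close> holds for every \<open>B\<close> with at least half the elements of
      \<open>A1\<close>, so it applies to the \<open>B\<close> that the upper bound later builds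
      from these four.\<close>
    obtain x y u v where xyuv: "x \<in> A1" "y \<in> A1" "u \<in> A1" "v \<in> A1"
      and large: "\<And>B. B \<subseteq> A1 \<Longrightarrow> card A1 \<le> 2 * card B \<Longrightarrow>
        real (card A1) ^ 3 \<le> 32 * M * card (set_add R ((x \<ominus> y) <# B) ((u \<ominus> v) <# B))"
      using large_sum_of_dilates[OF fin generated subset_trans[OF A1(1) Ac] True small1 sums1] by blast
    have pop: "N \<le> card ((a <# A) \<inter> (b <# A))" if "a \<in> A1" for a
      using that by (simp add: A1_def f_def)
    have N0: "N > 0" using N(1) by simp
    obtain B where B: "B \<subseteq> A1" "card A1 \<le> 2 * card B" and le:
      "card (set_add R ((x \<ominus> y) <# B) ((u \<ominus> v) <# B)) * real N ^ 4 * real (card A) ^ 3 \<le> 2 ^ 16 * M ^ 8"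
      by (rule sum_of_dilates_le[OF A(1) finA b(1) A1(1) A1ne N0 pop sums xyuv])
    define D where "D = real (card (set_add R ((x \<ominus> y) <# B) ((u \<ominus> v) <# B)))"
    have "m ^ 3 * real N ^ 4 * n ^ 3 \<le> (32 * M * D) * real N ^ 4 * n ^ 3"
      using large[OF B] n by (intro mult_right_mono) (auto simp: m_def D_def)
    also have "\<dots> = 32 * M * (D * real N ^ 4 * n ^ 3)"
      by (simp only: mult_ac)
    also have "\<dots> \<le> 32 * M * (2 ^ 16 * M ^ 8)"
      using le nM n by (intro mult_left_mono) (auto simp: D_def n_def)
    also have "\<dots> = 2 ^ 21 * M ^ 9"
      by (simp flip: power_Suc)
    finally show ?thesis .
  qed
  show ?thesis
    using sum_product_exponents[OF _ _ _ _ _ popular mn core] n m nM L by (simp add: n_def L_def)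
qed

section \<open>Prime fields, removal of zero and the final constants\<close>

theorem theorem2p1:
  shows "\<exists>C \<alpha> :: real. C > 0 \<and> \<alpha> \<ge> 0 \<and>
    (\<forall>(p :: nat) (A :: int set).
       prime p \<longrightarrow>
       A \<subseteq> carrier (residue_ring (int p)) \<longrightarrow>
       2 \<le> card A \<longrightarrow>
       real (card A) < real p powr (1 / 2) \<longrightarrow>
       real (card A) powr (14 / 13)
         \<le> C * ln (real (card A)) powr \<alpha> *
            real (max (card (A <#>\<^bsub>residue_ring (int p)\<^esub> A))
                      (card (A <+>\<^bsub>residue_ring (int p)\<^esub> A))))"
proof (intro exI conjI allI impI)
  \<comment> \<open>The constant is the 13th root of \<open>2 ^ 14 * 2 ^ 21 * 3 ^ 4\<close>: the
    factors come from \<open>n <= 2 * n'\<close>, from the estimate without zero, and from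
    \<open>1 + ln n' <= 3 * ln n\<close>.\<close>
  show "(0::real) < (2 ^ 35 * 3 ^ 4) powr (1 / 13)" "(0::real) \<le> 4 / 13"
    by simp_all
next
  fix p :: nat and A :: "int set"
  assume p: "prime p" and A: "A \<subseteq> carrier (residue_ring (int p))" and two: "2 \<le> card A"
    and small: "real (card A) < real p powr (1 / 2)"
  define R where "R = residue_ring (int p)"
  interpret residues_prime p R
    by unfold_locales (use p in \<open>simp_all add: R_def\<close>)
  define S where "S = card (set_add R A A)"
  define P where "P = card (A <#>\<^bsub>R\<^esub> A)"
  define M where "M = real (max P S)"
  \<comment> \<open>Zero is removed because dilation by each element has to be injective. As
    \<open>n >= 2\<close>, this at most halves the set.\<close>
  define A' where "A' = A - {\<zero>\<^bsub>R\<^esub>}"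
  define n where "n = real (card A)"
  define n' where "n' = real (card A')"
  have fin: "finite (carrier R)" and Ac: "A \<subseteq> carrier R" and A': "A' \<subseteq> carrier R - {\<zero>\<^bsub>R\<^esub>}"
    using A by (auto simp: R_def A'_def residue_ring_def)
  have finA: "finite A"
    using Ac fin by (rule finite_subset)
  have cardR: "card (carrier R) = p"
    by (simp add: R_def residue_ring_def)
  have "card A' \<ge> card A - 1"
    unfolding A'_def using finA by (simp add: card_Diff_singleton_if)
  then have n': "n \<le> 2 * n'" "n' \<ge> 1"
    using two by (auto simp: n_def n'_def)
  have n'n: "n' \<le> n" and n: "n \<ge> 2"
    using finA two by (auto simp: n_def n'_def A'_def card_Diff1_le)
  have "n ^ 2 < (real p powr (1 / 2)) ^ 2"
    using small by (intro power_strict_mono) (auto simp: n_def)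
  also have "(real p powr (1 / 2)) ^ 2 = real p"
    by (simp add: powr_half_sqrt)
  finally have "n'\<^sup>2 < real p"
    using power_mono[OF n'n, of 2] n'(2) by simp
  then have small': "(card A')\<^sup>2 < card (carrier R)"
    unfolding n'_def cardR of_nat_power[symmetric] of_nat_less_iff .
  \<comment> \<open>Repeatedly adding one to zero reaches every residue; as long as
    \<open>k < p\<close>, no reduction modulo \<open>p\<close> occurs.\<close>
  have generated: "carrier R \<subseteq> Q"
    if "\<zero>\<^bsub>R\<^esub> \<in> Q" and step: "\<And>q. q \<in> carrier R \<Longrightarrow> q \<in> Q \<Longrightarrow> q \<oplus>\<^bsub>R\<^esub> \<one>\<^bsub>R\<^esub> \<in> Q" for Q
  proof -
    have *: "k < p \<Longrightarrow> int k \<in> Q" for k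
    proof (induction k)
      case 0
      then show ?case using that(1) by (simp add: res_zero_eq)
    next
      case (Suc k)
      then have "int k \<oplus>\<^bsub>R\<^esub> \<one>\<^bsub>R\<^esub> \<in> Q"
        by (intro step) (auto simp: res_carrier_eq)
      then show ?case
        using Suc.prems by (simp add: res_add_eq res_one_eq add.commute)
    qed
    show ?thesis
    proof
      fix x assume "x \<in> carrier R"
      then show "x \<in> Q"
        using *[of "nat x"] by (auto simp: res_carrier_eq nat_less_iff)
    qed
  qed
  have "card (set_add R A' A') \<le> S"
    unfolding S_def using finA by (intro card_mono set_add_mono) (auto simp: A'_def)
  then have sums: "card (set_add R A' A') \<le> M"
    by (simp add: M_def)
  have "card (A' <#>\<^bsub>R\<^esub> A') \<le> P"
    unfolding P_def using finA by (intro card_mono mono_set_mult) (auto simp: A'_def set_mult_def)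
  then have products: "card (A' <#>\<^bsub>R\<^esub> A') \<le> M"
    by (simp add: M_def)
  have A'ne: "A' \<noteq> {}"
    using n'(2) by (auto simp: n'_def)
  have bound: "n' ^ 14 \<le> 2 ^ 21 * M ^ 13 * (1 + ln n') ^ 4"
    unfolding n'_def
    by (rule sum_product_nonzero[OF fin generated A' A'ne small' sums products])
  have M: "M \<ge> 0"
    by (simp add: M_def)
  \<comment> \<open>A lower bound for \<open>ln 2\<close> lets \<open>2 * ln n\<close> absorb the 1
    in \<open>1 + ln n'\<close>.\<close>
  have "ln (1 / 2 :: real) \<le> 1 / 2 - 1"
    by (intro ln_le_minus_one) auto
  moreover have "ln 2 \<le> ln n"
    using n by simp
  ultimately have ln_half: "ln n \<ge> 1 / 2"
    by (simp add: ln_div)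
  have "ln n' \<le> ln n"
    using n'(2) n'n by simp
  then have "1 + ln n' \<le> 3 * ln n"
    using ln_half by linarith
  then have ln4: "(1 + ln n') ^ 4 \<le> (3 * ln n) ^ 4"
    using n'(2) by (intro power_mono) auto
  have "n ^ 14 \<le> (2 * n') ^ 14"
    using n'(1) n by (intro power_mono) auto
  also have "\<dots> = 2 ^ 14 * n' ^ 14"
    by (simp add: power_mult_distrib)
  also have "\<dots> \<le> 2 ^ 14 * (2 ^ 21 * M ^ 13 * (1 + ln n') ^ 4)"
    using bound by simp
  also have "\<dots> \<le> 2 ^ 14 * (2 ^ 21 * M ^ 13 * (3 * ln n) ^ 4)"
    using ln4 M by (intro mult_left_mono) auto
  also have "\<dots> = (2 ^ 35 * 3 ^ 4) * ln n ^ 4 * M ^ 13"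
    by (simp add: power_mult_distrib)
  finally have main: "n ^ 14 \<le> (2 ^ 35 * 3 ^ 4) * ln n ^ 4 * M ^ 13" .
  have power_powr: "(x ^ k) powr a = x powr (real k * a)" if "x > 0" for x a :: real and k :: nat
    using that by (simp add: powr_powr flip: powr_realpow)
  have "n powr (14 / 13) = (n ^ 14) powr (1 / 13)"
    using n by (simp add: power_powr)
  also have "\<dots> \<le> ((2 ^ 35 * 3 ^ 4) * ln n ^ 4 * M ^ 13) powr (1 / 13)"
    using main n by (intro powr_mono2) auto
  also have "\<dots> = (2 ^ 35 * 3 ^ 4) powr (1 / 13) * (ln n ^ 4) powr (1 / 13) * (M ^ 13) powr (1 / 13)"
    using M ln_half by (simp add: powr_mult)
  also have "(ln n ^ 4) powr (1 / 13) = ln n powr (4 / 13)"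
    using ln_half by (simp add: power_powr)
  \<comment> \<open>\<open>power_powr\<close> requires a positive base; for \<open>M = 0\<close>
    both sides vanish, since zero \<open>powr\<close> anything is zero.\<close>
  also have "(M ^ 13) powr (1 / 13) = M"
    using M by (cases "M = 0") (simp_all add: power_powr)
  finally show "real (card A) powr (14 / 13)
      \<le> (2 ^ 35 * 3 ^ 4) powr (1 / 13) * ln (real (card A)) powr (4 / 13) *
        real (max (card (A <#>\<^bsub>residue_ring (int p)\<^esub> A))
                  (card (A <+>\<^bsub>residue_ring (int p)\<^esub> A)))"
    by (simp add: n_def M_def P_def S_def R_def)
qed

end
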